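(* $\widetilde{\mathcal U}_{\mathbb Z}\subsetneq\widetilde{\mathcal U}_{\mathbb Z,M}$. More precisely: $$\mathbb Z^{(div)}[X_{2r+1}^\pm\mid r\in\mathbb Z]\subsetneq\mathbb Z^{(div)}[y_{2r+1}^\pm\mid r\in\mathbb Z],$$ so that $\widetilde{\mathcal U}_{\mathbb Z}^+\subsetneq\widetilde{\mathcal U}_{\mathbb Z,M}^+$ and $\widetilde{\mathcal U}_{\mathbb Z}^-\subsetneq\widetilde{\mathcal U}_{\mathbb Z,M}^-$; $$\mathbb Z^{(bin)}[h_0,c]=\mathbb Z^{(bin)}[2\mathsf h_0,4\tilde c]\subsetneq\mathbb Z^{(bin)}[2\mathsf h_0,\tilde c-\mathsf h_0]$$ and $$\mathbb Z^{(sym)}[\varepsilon_rh_r\mid r>0]\subsetneq\mathbb Z^{(sym)}[\mathsf h_r\mid r>0]$$ (and similarly $\mathbb Z^{(sym)}[\varepsilon_rh_{-r}\mid r>0]\subsetneq\mathbb Z^{(sym)}[\mathsf h_{-r}\mid r>0]$), so that $\widetilde{\mathcal U}_{\mathbb Z}^0\subsetneq\widetilde{\mathcal U}_{\mathbb Z,M}^0$.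
   Context: $\mathbb N=\{0,1,2,\dots\}$. For $a$ in a unital $\mathbb Q$-algebra: $a^{(k)}=a^k/k!$, $\binom ak=a(a-1)\cdots(a-k+1)/k!$. For commuting algebraically independent elements: $\mathbb Z^{(div)}[a_i]$ is the $\mathbb Z$-subalgebra generated by all $a_i^{(k)}$; $\mathbb Z^{(bin)}[a_i]$ is the $\mathbb Z$-subalgebra generated by all $\binom{a_i}{k}$; $\mathbb Z^{(sym)}[a_r\mid r>0]$ is the $\mathbb Z$-subalgebra generated by the coefficients of $\exp\big(\sum_{r>0}(-1)^{r-1}\frac{a_r}{r}u^r\big)$. The Lie algebra of type $A_2^{(2)}$ (and its enveloping algebra $\widetilde{\mathcal U}$, as associative algebra) is generated over $\mathbb Q$ by $\{c,h_r,x_r^\pm,X_{2r+1}^\pm\mid r\in\mathbb Z\}$ (a basis of the Lie algebra) with relations: $c$ central; $[h_r,h_s]=\delta_{r+s,0}\,2r(2+(-1)^{r-1})c$; $[h_r,x_s^\pm]=\pm2(2+(-1)^{r-1})x_{r+s}^\pm$; for $s$ odd, $[h_r,X_s^\pm]=\pm4X_{r+s}^\pm$ if $r$ is even and $0$ if $r$ is odd; $[x_r^\pm,x_s^\pm]=0$ if $r+s$ is even and $\pm(-1)^sX_{r+s}^\pm$ if $r+s$ is odd; $[x_r^\pm,X_s^\pm]=[X_r^\pm,X_s^\pm]=0$; $[x_r^+,x_s^-]=h_{r+s}+\delta_{r+s,0}\,rc$; $[x_r^\pm,X_s^\mp]=\pm(-1)^r4x_{r+s}^\mp$ ($s$ odd);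 $[X_r^+,X_s^-]=8h_{r+s}+4\delta_{r+s,0}\,rc$ ($r,s$ odd). Put $\varepsilon_r=-1$ if $4\mid r$, $\varepsilon_r=1$ otherwise; $y_{2r+1}^\pm=\frac14X_{2r+1}^\pm$, $\mathsf h_r=\frac12h_r$, $\tilde c=\frac14c$. $\widetilde{\mathcal U}_{\mathbb Z}$, $\widetilde{\mathcal U}_{\mathbb Z}^+$, $\widetilde{\mathcal U}_{\mathbb Z}^-$ are the $\mathbb Z$-subalgebras of $\widetilde{\mathcal U}$ generated respectively by $\{(x_r^+)^{(k)},(x_r^-)^{(k)}\}$, $\{(x_r^+)^{(k)}\}$, $\{(x_r^-)^{(k)}\}$ ($r\in\mathbb Z,k\in\mathbb N$); $\widetilde{\mathcal U}_{\mathbb Z}^0$ is the $\mathbb Z$-subalgebra generated by $\mathbb Z^{(sym)}[\varepsilon_rh_{-r}\mid r>0]$, $\mathbb Z^{(bin)}[h_0,c]$ and $\mathbb Z^{(sym)}[\varepsilon_rh_r\mid r>0]$. Mitzman's integral form $\widetilde{\mathcal U}_{\mathbb Z,M}$ is the $\mathbb Z$-subalgebra of $\widetilde{\mathcal U}$ generated by the divided powers of the Kac-Moody (Chevalley) generators $e_1=x_0^+$, $f_1=x_0^-$, $e_0=y_1^-$, $f_0=y_{-1}^+$, i.e. by $\{(x_0^\pm)^{(k)},(y_{\mp1}^\pm)^{(k)}\mid k\in\mathbb N\}$. Moreover (as images of the multiplication map in $\widetilde{\mathcal U}$) $\widetilde{\mathcal U}_{\mathbb Z,M}^\pm=\mathbb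 Z^{(div)}[x_{2r}^\pm\mid r\in\mathbb Z]\cdot\mathbb Z^{(div)}[y_{2r+1}^\pm\mid r\in\mathbb Z]\cdot\mathbb Z^{(div)}[x_{2r+1}^\pm\mid r\in\mathbb Z]$ and $\widetilde{\mathcal U}_{\mathbb Z,M}^0=\mathbb Z^{(sym)}[\mathsf h_{-r}\mid r>0]\cdot\mathbb Z^{(bin)}[2\mathsf h_0,\tilde c-\mathsf h_0]\cdot\mathbb Z^{(sym)}[\mathsf h_r\mid r>0]$. (Mitzman's theorem: $\widetilde{\mathcal U}_{\mathbb Z,M}\cong\widetilde{\mathcal U}_{\mathbb Z,M}^-\otimes_{\mathbb Z}\widetilde{\mathcal U}_{\mathbb Z,M}^0\otimes_{\mathbb Z}\widetilde{\mathcal U}_{\mathbb Z,M}^+$ via multiplication.) *)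

theory Defs
  imports
    "HOL-Library.Poly_Mapping"
    "HOL-Computational_Algebra.Formal_Power_Series"
    "HOL-Computational_Algebra.Group_Closure"
begin

section \<open>The free associative algebra\<close>

text \<open>The free monoid, written additively, so that \<open>'g word \<Rightarrow>\<^sub>0 rat\<close> with the convolution product
  of \<^theory>\<open>HOL-Library.Poly_Mapping\<close> is the free associative unital \<open>\<rat>\<close>-algebra on \<open>'g\<close>.\<close>

datatype 'g word = Word (letters: "'g list")

instantiation word :: (type) monoid_add
begin

definition zero_word :: "'g word" where
  "zero_word = Word []"

definition plus_word :: "'g word \<Rightarrow> 'g word \<Rightarrow> 'g word" where
  "plus_word v w = Word (letters v @ letters w)"

instance
  by standard (simp_all add: zero_word_def plus_word_def)

end

type_synonym 'g free_alg = "'g word \<Rightarrow>\<^sub>0 rat"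

definition fgen :: "'g \<Rightarrow> 'g free_alg" where
  "fgen g = Poly_Mapping.single (Word [g]) 1"

definition fscal :: "rat \<Rightarrow> 'g free_alg" where
  "fscal q = Poly_Mapping.single 0 q"

definition commutator :: "'a::ring_1 \<Rightarrow> 'a \<Rightarrow> 'a" where
  "commutator a b = a * b - b * a"


section \<open>The enveloping algebra of type \<open>A\<^sub>2\<^sup>(\<^sup>2\<^sup>)\<close>\<close>

datatype pm = Plus | Minus

fun sgn_pm :: "pm \<Rightarrow> rat" where
  "sgn_pm Plus = 1"
| "sgn_pm Minus = - 1"

fun opp :: "pm \<Rightarrow> pm" where
  "opp Plus = Minus"
| "opp Minus = Plus"

text \<open>The generator \<open>X\<^sub>2\<^sub>r\<^sub>+\<^sub>1\<^sup>\<plusminus>\<close> is encoded as \<open>GXX p r\<close>, so that exactly the odd-indexed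
  generators exist.\<close>

datatype gen = Gc | Gh int | Gx pm int | GXX pm int

abbreviation fc :: "gen free_alg" where "fc \<equiv> fgen Gc"
abbreviation fh :: "int \<Rightarrow> gen free_alg" where "fh r \<equiv> fgen (Gh r)"
abbreviation fx :: "pm \<Rightarrow> int \<Rightarrow> gen free_alg" where "fx p r \<equiv> fgen (Gx p r)"

text \<open>\<open>fXX p s\<close> stands for \<open>X\<^sub>s\<^sup>\<plusminus>\<close>; it is only used with \<open>s\<close> odd, where \<open>s = 2 * (s div 2) + 1\<close>.\<close>

abbreviation fXX :: "pm \<Rightarrow> int \<Rightarrow> gen free_alg" where "fXX p s \<equiv> fgen (GXX p (s div 2))"

text \<open>Each relation \<open>lhs = rhs\<close> is recorded as the element \<open>lhs - rhs\<close>.\<close>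

inductive_set relators :: "gen free_alg set" where
  c_central: "commutator fc (fgen g) \<in> relators"
| h_h: "commutator (fh r) (fh s)
    - (if r + s = 0 then fscal (2 * of_int r * (2 + (-1) powi (r - 1))) * fc else 0) \<in> relators"
| h_x: "commutator (fh r) (fx p s)
    - fscal (sgn_pm p * 2 * (2 + (-1) powi (r - 1))) * fx p (r + s) \<in> relators"
| h_X: "odd s \<Longrightarrow> commutator (fh r) (fXX p s)
    - (if even r then fscal (sgn_pm p * 4) * fXX p (r + s) else 0) \<in> relators"
| x_x: "commutator (fx p r) (fx p s)
    - (if odd (r + s) then fscal (sgn_pm p * (-1) powi s) * fXX p (r + s) else 0) \<in> relators"
| x_X: "odd s \<Longrightarrow> commutator (fx p r) (fXX p s) \<in> relators"
| X_X: "odd r \<Longrightarrow> odd s \<Longrightarrow> commutator (fXX p r) (fXX p s) \<in> relators"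
| x_x_opp: "commutator (fx Plus r) (fx Minus s)
    - (fh (r + s) + (if r + s = 0 then fscal (of_int r) * fc else 0)) \<in> relators"
| x_X_opp: "odd s \<Longrightarrow> commutator (fx p r) (fXX (opp p) s)
    - fscal (sgn_pm p * (-1) powi r * 4) * fx (opp p) (r + s) \<in> relators"
| X_X_opp: "odd r \<Longrightarrow> odd s \<Longrightarrow> commutator (fXX Plus r) (fXX Minus s)
    - (fscal 8 * fh (r + s) + (if r + s = 0 then fscal (4 * of_int r) * fc else 0)) \<in> relators"

text \<open>The two-sided ideal generated by the relators; closure under scalars is automatic because the
  factors \<open>a\<close> and \<open>b\<close> range over the whole \<open>\<rat>\<close>-algebra.\<close>

definition rel_ideal :: "gen free_alg set" where
  "rel_ideal = group_closure {a * t * b | a t b. t \<in> relators}"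

lemma rel_ideal_add: "f \<in> rel_ideal \<Longrightarrow> g \<in> rel_ideal \<Longrightarrow> f + g \<in> rel_ideal"
  by (simp add: rel_ideal_def group_closure_add)

lemma rel_ideal_uminus: "f \<in> rel_ideal \<Longrightarrow> - f \<in> rel_ideal"
  by (simp add: rel_ideal_def)

lemma rel_ideal_mult:
  assumes "f \<in> rel_ideal"
  shows "g * f \<in> rel_ideal" and "f * g \<in> rel_ideal"
proof -
  have "g * f \<in> rel_ideal \<and> f * g \<in> rel_ideal"
    using assms unfolding rel_ideal_def
  proof (induction f rule: group_closure.induct)
    case (base s)
    show ?case
    proof (cases "s = 0")
      case False
      then obtain a t b where s: "s = a * t * b" and t: "t \<in> relators"
        using base by auto
      have "g * s = (g * a) * t * b" "s * g = a * t * (b * g)"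
        by (simp_all add: s mult.assoc)
      with t have "g * s \<in> {a * t * b | a t b. t \<in> relators}"
        "s * g \<in> {a * t * b | a t b. t \<in> relators}"
        by blast+
      then show ?thesis
        by (auto intro!: group_closure.base)
    qed simp
  next
    case (diff s t)
    then show ?case
      by (auto simp: algebra_simps intro!: group_closure.diff)
  qed
  then show "g * f \<in> rel_ideal" "f * g \<in> rel_ideal"
    by auto
qed

lemma lookup_mult_0:
  fixes f g :: "'g free_alg"
  shows "Poly_Mapping.lookup (f * g) 0 = Poly_Mapping.lookup f 0 * Poly_Mapping.lookup g 0"
proof -
  have *: "0 = l + q \<longleftrightarrow> l = 0 \<and> q = 0" for l q :: "'g word"
    by (cases l; cases q) (auto simp: zero_word_def plus_word_def)
  have "(\<Sum>q. Poly_Mapping.lookup g q when 0 = l + q) = (Poly_Mapping.lookup g 0 when l = 0)" for l :: "'g word"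
  proof (cases "l = 0")
    case True
    have "(\<lambda>q. Poly_Mapping.lookup g q when 0 = l + q) = (\<lambda>q. Poly_Mapping.lookup g q when q = 0)"
      using True by (auto simp: fun_eq_iff when_def)
    then show ?thesis
      using True by simp
  qed (simp add: * when_def)
  then show ?thesis
    by (simp add: lookup_mult mult_when)
qed

lemma lookup_relator_0:
  assumes "t \<in> relators"
  shows "Poly_Mapping.lookup t 0 = 0"
proof -
  have [simp]: "Poly_Mapping.lookup (fgen g) 0 = 0" for g :: gen
    by (simp add: fgen_def zero_word_def lookup_single when_def)
  from assms show ?thesis
    by (cases rule: relators.cases)
      (auto simp: commutator_def lookup_mult_0 lookup_minus lookup_add)
qed

lemma one_notin_rel_ideal: "1 \<notin> rel_ideal"
proof -
  have "Poly_Mapping.lookup f 0 = 0" if "f \<in> rel_ideal" for f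
    using that unfolding rel_ideal_def
    by (induction f rule: group_closure.induct)
      (auto simp: lookup_mult_0 lookup_relator_0 lookup_minus)
  then show ?thesis
    by force
qed

quotient_type env = "gen free_alg" / "\<lambda>f g. f - g \<in> rel_ideal"
proof (rule equivpI)
  show "reflp (\<lambda>f g. f - g \<in> rel_ideal)"
    by (simp add: reflp_def rel_ideal_def)
  show "symp (\<lambda>f g. f - g \<in> rel_ideal)"
    by (rule sympI) (drule rel_ideal_uminus, simp)
  show "transp (\<lambda>f g. f - g \<in> rel_ideal)"
  proof (rule transpI)
    fix a b d :: "gen free_alg"
    assume "a - b \<in> rel_ideal" "b - d \<in> rel_ideal"
    then have "(a - b) + (b - d) \<in> rel_ideal"
      by (rule rel_ideal_add)
    then show "a - d \<in> rel_ideal"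
      by simp
  qed
qed

instantiation env :: ring_1
begin

lift_definition zero_env :: env is 0 .

lift_definition one_env :: env is 1 .

lift_definition plus_env :: "env \<Rightarrow> env \<Rightarrow> env" is "(+)"
  by (simp add: add_diff_add rel_ideal_add)

lift_definition uminus_env :: "env \<Rightarrow> env" is uminus
  by (simp only: minus_diff_minus rel_ideal_uminus)

lift_definition minus_env :: "env \<Rightarrow> env \<Rightarrow> env" is "(-)"
proof -
  fix a b c d :: "gen free_alg"
  assume "a - b \<in> rel_ideal" "c - d \<in> rel_ideal"
  then have "(a - b) + - (c - d) \<in> rel_ideal"
    by (intro rel_ideal_add rel_ideal_uminus)
  then show "a - c - (b - d) \<in> rel_ideal"
    by (simp add: algebra_simps)
qed

lift_definition times_env :: "env \<Rightarrow> env \<Rightarrow> env" is "(*)"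
proof -
  fix a b c d :: "gen free_alg"
  assume "a - b \<in> rel_ideal" "c - d \<in> rel_ideal"
  then have "(a - b) * c + b * (c - d) \<in> rel_ideal"
    by (intro rel_ideal_add rel_ideal_mult)
  then show "a * c - b * d \<in> rel_ideal"
    by (simp add: algebra_simps)
qed

instance
proof
  show "(0::env) \<noteq> 1"
    using rel_ideal_uminus [of "- 1"] by transfer (auto simp: one_notin_rel_ideal)
qed (transfer, simp add: algebra_simps rel_ideal_def)+

end

lift_definition ugen :: "gen \<Rightarrow> env" is fgen .

text \<open>The structure map of the \<open>\<rat>\<close>-algebra: scalar multiplication by \<open>q\<close> is \<open>scal q * a\<close>.\<close>

lift_definition scal :: "rat \<Rightarrow> env" is fscal .

definition cU :: env where "cU = ugen Gc"
definition hU :: "int \<Rightarrow> env" where "hU r = ugen (Gh r)"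
definition xU :: "pm \<Rightarrow> int \<Rightarrow> env" where "xU p r = ugen (Gx p r)"

text \<open>The elements \<open>X\<^sub>2\<^sub>r\<^sub>+\<^sub>1\<^sup>\<plusminus>\<close> and \<open>y\<^sub>2\<^sub>r\<^sub>+\<^sub>1\<^sup>\<plusminus>\<close> are \<open>X_odd p r\<close> and \<open>y_odd p r\<close>.\<close>

definition X_odd :: "pm \<Rightarrow> int \<Rightarrow> env" where "X_odd p r = ugen (GXX p r)"
definition y_odd :: "pm \<Rightarrow> int \<Rightarrow> env" where "y_odd p r = scal (1/4) * X_odd p r"

definition hh :: "int \<Rightarrow> env" where "hh r = scal (1/2) * hU r"
definition c_tilde :: env where "c_tilde = scal (1/4) * cU"

definition eps :: "int \<Rightarrow> rat" where "eps r = (if 4 dvd r then - 1 else 1)"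


section \<open>Integral subalgebras\<close>

inductive_set int_subalg :: "'a::ring_1 set \<Rightarrow> 'a set" for S where
  one: "1 \<in> int_subalg S"
| base: "a \<in> S \<Longrightarrow> a \<in> int_subalg S"
| diff: "a \<in> int_subalg S \<Longrightarrow> b \<in> int_subalg S \<Longrightarrow> a - b \<in> int_subalg S"
| mult: "a \<in> int_subalg S \<Longrightarrow> b \<in> int_subalg S \<Longrightarrow> a * b \<in> int_subalg S"

text \<open>The image of \<open>A \<otimes>\<^sub>\<int> B \<otimes>\<^sub>\<int> C\<close> under multiplication, i.e. all sums of products.\<close>

definition mult_image :: "'a::ring_1 set \<Rightarrow> 'a set \<Rightarrow> 'a set \<Rightarrow> 'a set" where
  "mult_image A B C = group_closure {a * b * d | a b d. a \<in> A \<and> b \<in> B \<and> d \<in> C}"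

definition dpow :: "env \<Rightarrow> nat \<Rightarrow> env" where
  "dpow a k = scal (1 / fact k) * a ^ k"

text \<open>The library's \<^const>\<open>gbinomial\<close> requires a commutative integral domain.\<close>

definition ubinom :: "env \<Rightarrow> nat \<Rightarrow> env" where
  "ubinom a k = scal (1 / fact k) * prod_list (map (\<lambda>i. a - of_nat i) [0..<k])"

definition Zdiv :: "env set \<Rightarrow> env set" where
  "Zdiv S = int_subalg {dpow a k | a k. a \<in> S}"

definition Zbin :: "env set \<Rightarrow> env set" where
  "Zbin S = int_subalg {ubinom a k | a k. a \<in> S}"

text \<open>\<open>exp f\<close>, as the composition of the exponential series with \<open>f\<close>, for \<open>f\<close> without constant
  term.\<close>

definition exp_series :: "env fps \<Rightarrow> env fps" where
  "exp_series f = Abs_fps (\<lambda>k. scal (1 / fact k)) oo f"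

text \<open>Only the values \<open>a r\<close> with \<open>r > 0\<close> matter.\<close>

definition Zsym :: "(nat \<Rightarrow> env) \<Rightarrow> env set" where
  "Zsym a = int_subalg (range (fps_nth (exp_series
     (Abs_fps (\<lambda>r. if r = 0 then 0 else scal ((-1) ^ (r - 1) / of_nat r) * a r)))))"

definition U_Z :: "env set" where
  "U_Z = int_subalg {dpow (xU p r) k | p r k. True}"

definition U_Z_pm :: "pm \<Rightarrow> env set" where
  "U_Z_pm p = int_subalg {dpow (xU p r) k | r k. True}"

definition U_Z_0 :: "env set" where
  "U_Z_0 = int_subalg
     (Zsym (\<lambda>r. scal (eps (int r)) * hU (- int r)) \<union> Zbin {hU 0, cU}
      \<union> Zsym (\<lambda>r. scal (eps (int r)) * hU (int r)))"

text \<open>Here \<open>y\<^sub>1\<^sup>- = y_odd Minus 0\<close> and \<open>y\<^sub>-\<^sub>1\<^sup>+ = y_odd Plus (-1)\<close>.\<close>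

definition U_ZM :: "env set" where
  "U_ZM = int_subalg
     {dpow e k | e k. e \<in> {xU Plus 0, xU Minus 0, y_odd Minus 0, y_odd Plus (-1)}}"

definition U_ZM_pm :: "pm \<Rightarrow> env set" where
  "U_ZM_pm p = mult_image (Zdiv (range (\<lambda>r. xU p (2 * r)))) (Zdiv (range (y_odd p)))
     (Zdiv (range (\<lambda>r. xU p (2 * r + 1))))"

definition U_ZM_0 :: "env set" where
  "U_ZM_0 = mult_image (Zsym (\<lambda>r. hh (- int r))) (Zbin {2 * hh 0, c_tilde - hh 0})
     (Zsym (\<lambda>r. hh (int r)))"

end

theory Submission
  imports Defs
begin

text \<open>A series \<open>exp f\<close> with commuting coefficients is determined by the equation
  \<open>u d/du (exp f) = (u df/du) exp f\<close>; divided powers, binomials and the generators of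
  \<open>\<int>\<^sup>(\<^sup>s\<^sup>y\<^sup>m\<^sup>)\<close> are all coefficients of such series. If \<open>[f, g]\<close> is central, then
  \<open>exp f exp g = exp g exp [f, g] exp f\<close>; this straightening shows that Mitzman's products of
  three subalgebras are closed under multiplication. The divided powers of all real root vectors
  lie in Mitzman's form because each is obtained from a Chevalley generator by taking ends of root
  strings. All inclusions are strict because, in a representation of the loop algebra of \<open>sl\<^sub>3\<close> by
  differential operators on monomials with rational exponents, the smaller subalgebra preserves a
  lattice which some element of the larger one does not.\<close>

unbundle fps_syntax

section \<open>Scalars and commutation in the enveloping algebra\<close>

text \<open>Non-membership requires neither a basis of the enveloping algebra nor a faithful
  representation: an additive group of functions preserved by a subring, but not by a given element,
  excludes that element. So \<open>c\<close> may act by zero. \<open>U_ZM_0\<close> and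
  \<open>U_ZM_pm\<close> are by definition only additive spans of ordered products; an inclusion
  into them does not follow from the inclusion of generators until they are known to be rings. Nor
  does strictness pass from subalgebras to the algebra that they generate, so one lattice must be
  preserved by all generators at once. Commutation is tracked explicitly in the identities of
  exponentials, because coefficients of different series need not commute.\<close>

lemma scal_add: "scal (p + q) = scal p + scal q"
  by transfer (simp add: fscal_def single_add rel_ideal_def)

lemma scal_diff: "scal (p - q) = scal p - scal q"
  by transfer (simp add: fscal_def single_diff rel_ideal_def)

lemma scal_mult: "scal (p * q) = scal p * scal q"
  by transfer (simp add: fscal_def mult_single rel_ideal_def)

lemma scal_0 [simp]: "scal 0 = 0"
  by transfer (simp add: fscal_def rel_ideal_def)

lemma scal_1 [simp]: "scal 1 = 1"
  by transfer (simp add: fscal_def rel_ideal_def)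

lemma scal_minus: "scal (- q) = - scal q"
  using scal_diff [of 0 q] by simp

lemma scal_of_nat: "scal (of_nat n) = of_nat n"
  by (induction n) (simp_all add: scal_add)

lemma scal_of_int: "scal (of_int n) = of_int n"
  by (cases n rule: int_cases2) (simp_all add: scal_of_nat scal_minus)

lemma scal_numeral: "scal (numeral n) = numeral n"
  using scal_of_nat [of "numeral n"] by simp

lemma free_alg_induct [case_names zero single add]:
  assumes "P 0" "\<And>w q. P (Poly_Mapping.single w q)" "\<And>f g. P f \<Longrightarrow> P g \<Longrightarrow> P (f + g)"
  shows "P (f :: 'g free_alg)"
proof (induction f rule: update_induct)
  case (update f a b)
  have "Poly_Mapping.update a b f = f + Poly_Mapping.single a b"
    using update by (intro poly_mapping_eqI)
      (auto simp: lookup_update lookup_add lookup_single when_def in_keys_iff)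
  with update assms show ?case by simp
qed (rule assms)

lemma fscal_commute: "fscal q * f = f * fscal q"
  by (induction f rule: free_alg_induct)
    (simp_all add: distrib_left distrib_right, simp add: fscal_def mult_single mult.commute)

lemma scal_commute: "scal q * a = a * scal q"
  by transfer (simp add: fscal_commute rel_ideal_def)

lemma scal_left_commute: "a * (scal q * b) = scal q * (a * b)"
  by (metis mult.assoc scal_commute)

lemma mult_scal_left: "scal p * (scal q * b) = scal (p * q) * b"
  by (simp add: scal_mult mult.assoc)

lemma scal_cancel: "q \<noteq> 0 \<Longrightarrow> scal q * a = scal q * b \<longleftrightarrow> a = b"
  by (metis mult_scal_left left_inverse mult_1 scal_1)

text \<open>Rational scalars make the algebra torsion-free; this turns a relation for
  \<open>n * F $ n\<close> into one for \<open>F $ n\<close>.\<close>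

lemma of_nat_mult_env_cancel: "n > 0 \<Longrightarrow> of_nat n * (a::env) = of_nat n * b \<longleftrightarrow> a = b"
  using scal_cancel [of "of_nat n" a b] by (simp add: scal_of_nat)

lemma of_nat_mult_scal: "of_nat n * (scal q * a) = scal (of_nat n * q) * a"
  by (simp add: scal_mult scal_of_nat mult.assoc)

lemma commutator_add_right: "commutator a (b + d) = commutator a b + commutator a d"
  by (simp add: commutator_def algebra_simps)

lemma commutator_scal_left: "commutator (scal q * a) b = scal q * commutator a b"
  by (simp add: commutator_def algebra_simps scal_left_commute)

lemma commutator_scal_right: "commutator a (scal q * b) = scal q * commutator a b"
  by (simp add: commutator_def algebra_simps scal_left_commute)

lemma commutator_swap: "commutator a b = - commutator b a"
  by (simp add: commutator_def)

lemma commutator_0_iff: "commutator a b = 0 \<longleftrightarrow> a * b = b * a"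
  by (simp add: commutator_def)

section \<open>The defining relations in the quotient\<close>

lemma abs_env_relator: "t \<in> relators \<Longrightarrow> abs_env t = 0"
proof -
  assume "t \<in> relators"
  then have "1 * t * 1 \<in> {a * t * b | a t b. t \<in> relators}"
    by blast
  then have "t \<in> rel_ideal"
    by (auto simp: rel_ideal_def intro: group_closure.base)
  then show ?thesis
    unfolding zero_env.abs_eq by (subst env.abs_eq_iff) simp
qed

lemma abs_env_add: "abs_env (f + g) = abs_env f + abs_env g"
  by (simp add: plus_env.abs_eq)

lemma abs_env_diff: "abs_env (f - g) = abs_env f - abs_env g"
  by (simp add: minus_env.abs_eq)

lemma abs_env_mult: "abs_env (f * g) = abs_env f * abs_env g"
  by (simp add: times_env.abs_eq)

lemma abs_env_0: "abs_env 0 = 0"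
  by (simp add: zero_env.abs_eq)

lemma abs_env_commutator: "abs_env (commutator f g) = commutator (abs_env f) (abs_env g)"
  by (simp add: commutator_def abs_env_diff abs_env_mult)

lemmas env_relation = abs_env_diff abs_env_add abs_env_mult abs_env_0 abs_env_commutator
  scal.abs_eq [symmetric] ugen.abs_eq [symmetric]
  cU_def [symmetric] hU_def [symmetric] xU_def [symmetric] X_odd_def [symmetric]

lemma c_commute_gen: "commutator cU (ugen g) = 0"
  using abs_env_relator [OF relators.c_central [of g]] by (simp add: env_relation)

lemma h_h: "commutator (hU r) (hU s)
    = (if r + s = 0 then scal (2 * of_int r * (2 + (-1) powi (r - 1))) * cU else 0)"
  using abs_env_relator [OF relators.h_h [of r s]]
  by (simp add: env_relation split: if_splits)

lemma h_x: "commutator (hU r) (xU p s)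
    = scal (sgn_pm p * 2 * (2 + (-1) powi (r - 1))) * xU p (r + s)"
  using abs_env_relator [OF relators.h_x [of r p s]] by (simp add: env_relation)

text \<open>\<open>X_odd p s\<close> stands for the generator of index \<open>2 * s + 1\<close>;
  adding an even \<open>r\<close> to that index adds \<open>r div 2\<close> to
  \<open>s\<close>.\<close>

lemma h_X: "commutator (hU r) (X_odd p s)
    = (if even r then scal (sgn_pm p * 4) * X_odd p (r div 2 + s) else 0)"
proof -
  have "(r + (2 * s + 1)) div 2 = r div 2 + s" if "even r"
    using that by presburger
  then show ?thesis
    using abs_env_relator [OF relators.h_X [of "2 * s + 1" r p]]
    by (simp add: env_relation split: if_splits)
qed

lemma x_x: "commutator (xU p r) (xU p s)
    = (if odd (r + s) then scal (sgn_pm p * (-1) powi s) * X_odd p ((r + s) div 2) else 0)"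
  using abs_env_relator [OF relators.x_x [of p r s]] by (simp add: env_relation split: if_splits)

lemma x_X: "commutator (xU p r) (X_odd p s) = 0"
  using abs_env_relator [OF relators.x_X [of "2 * s + 1" p r]] by (simp add: env_relation)

lemma X_X: "commutator (X_odd p r) (X_odd p s) = 0"
  using abs_env_relator [OF relators.X_X [of "2 * r + 1" "2 * s + 1" p]]
  by (simp add: env_relation)

lemma x_x_opp: "commutator (xU Plus r) (xU Minus s)
    = hU (r + s) + (if r + s = 0 then scal (of_int r) * cU else 0)"
  using abs_env_relator [OF relators.x_x_opp [of r s]]
  by (simp add: env_relation split: if_splits)

lemma x_X_opp: "commutator (xU p r) (X_odd (opp p) s)
    = scal (sgn_pm p * (-1) powi r * 4) * xU (opp p) (r + (2 * s + 1))"
  using abs_env_relator [OF relators.x_X_opp [of "2 * s + 1" p r]] by (simp add: env_relation)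

lemma X_X_opp: "commutator (X_odd Plus r) (X_odd Minus s)
    = scal 8 * hU (2 * (r + s + 1)) + (if r + s + 1 = 0 then scal (4 * of_int (2 * r + 1)) * cU else 0)"
proof -
  have "2 * r + 1 + (2 * s + 1) = 2 * (r + s + 1)"
    by simp
  moreover have "2 * (r + s + 1) = 0 \<longleftrightarrow> r + s + 1 = 0"
    by arith
  ultimately show ?thesis
    using abs_env_relator [OF relators.X_X_opp [of "2 * r + 1" "2 * s + 1"]]
    by (simp add: env_relation split: if_splits del: distrib_left_numeral)
qed

lemma cU_commute_gens:
  "cU * hU r = hU r * cU" "cU * xU p r = xU p r * cU" "cU * X_odd p r = X_odd p r * cU"
  using c_commute_gen unfolding commutator_0_iff hU_def xU_def X_odd_def by auto

section \<open>Integral subalgebras and images of multiplication\<close>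

definition subring :: "'a::ring_1 set \<Rightarrow> bool" where
  "subring T \<longleftrightarrow> 1 \<in> T \<and> (\<forall>a\<in>T. \<forall>b\<in>T. a - b \<in> T \<and> a * b \<in> T)"

lemma subring_int_subalg: "subring (int_subalg S)"
  by (simp add: subring_def int_subalg.intros)

lemma int_subalg_least: "S \<subseteq> T \<Longrightarrow> subring T \<Longrightarrow> int_subalg S \<subseteq> T"
proof
  fix x assume "S \<subseteq> T" "subring T" "x \<in> int_subalg S"
  from this(3,1,2) show "x \<in> T"
    by induction (auto simp: subring_def)
qed

lemma
  assumes "subring T"
  shows subring_1: "1 \<in> T"
    and subring_0: "0 \<in> T"
    and subring_diff: "a \<in> T \<Longrightarrow> b \<in> T \<Longrightarrow> a - b \<in> T"
    and subring_uminus: "a \<in> T \<Longrightarrow> - a \<in> T"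
    and subring_add: "a \<in> T \<Longrightarrow> b \<in> T \<Longrightarrow> a + b \<in> T"
    and subring_mult: "a \<in> T \<Longrightarrow> b \<in> T \<Longrightarrow> a * b \<in> T"
proof -
  show 1: "1 \<in> T" and d: "\<And>a b. a \<in> T \<Longrightarrow> b \<in> T \<Longrightarrow> a - b \<in> T"
    and "a \<in> T \<Longrightarrow> b \<in> T \<Longrightarrow> a * b \<in> T"
    using assms by (auto simp: subring_def)
  show 0: "0 \<in> T" using d [OF 1 1] by simp
  show u: "- a \<in> T" if "a \<in> T" for a using d [OF 0 that] by simp
  show "a \<in> T \<Longrightarrow> b \<in> T \<Longrightarrow> a + b \<in> T" using d [of a "- b"] u [of b] by simp
qed

lemma subring_sum: "subring T \<Longrightarrow> (\<And>i. i \<in> I \<Longrightarrow> f i \<in> T) \<Longrightarrow> sum f I \<in> T"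
  by (induction I rule: infinite_finite_induct) (auto simp: subring_0 subring_add)

lemma subring_of_nat: "subring T \<Longrightarrow> of_nat n \<in> T"
  by (induction n) (auto simp: subring_0 subring_1 subring_add)

lemma subring_of_int: "subring T \<Longrightarrow> of_int n \<in> T"
  by (cases n rule: int_cases2) (auto simp: subring_of_nat subring_uminus)

lemma int_subalg_commute:
  assumes "\<And>s. s \<in> S \<Longrightarrow> s * b = b * s" and "a \<in> int_subalg S"
  shows "a * b = b * a"
  using assms(2)
proof induction
  case (mult u v)
  then show ?case by (metis mult.assoc)
qed (auto simp: assms(1) algebra_simps)

lemma group_closure_least:
  assumes "S \<subseteq> T" "0 \<in> T" "\<And>a b. a \<in> T \<Longrightarrow> b \<in> T \<Longrightarrow> a - b \<in> T"
  shows "group_closure S \<subseteq> T"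
proof
  fix x assume "x \<in> group_closure S"
  then show "x \<in> T" by induction (use assms in auto)
qed

lemma group_closure_subset: "S \<subseteq> group_closure T \<Longrightarrow> group_closure S \<subseteq> group_closure T"
  by (rule group_closure_least) (auto intro: group_closure.diff)

text \<open>Multiplication by \<open>l\<close> and \<open>r\<close> is additive, so only generators
  of the group have to be checked. Products of spans are reduced to products of generators in this
  way.\<close>

lemma group_closure_mult_mem:
  assumes "x \<in> group_closure S" "\<And>s. s \<in> S \<Longrightarrow> l * s * r \<in> group_closure T"
  shows "l * x * r \<in> group_closure (T :: 'a::ring_1 set)"
  using assms(1)
proof induction
  case (diff s t)
  then show ?case by (simp add: algebra_simps group_closure.diff)
qed (use assms(2) in auto)

lemma group_closure_sum: "(\<And>i. i \<in> I \<Longrightarrow> f i \<in> group_closure S) \<Longrightarrow> sum f I \<in> group_closure S"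
  by (induction I rule: infinite_finite_induct) (auto intro: group_closure_add)

lemma mult_image_memI:
  "a \<in> A \<Longrightarrow> b \<in> B \<Longrightarrow> d \<in> C \<Longrightarrow> a * b * d \<in> mult_image A B C"
  unfolding mult_image_def by (intro group_closure.base) auto

text \<open>The generators of \<open>A\<close> come in families indexed by \<open>i\<close>, and straightening a product
  \<open>\<alpha> i m * b\<close> only produces members of the same family; this is what makes the induction over
  \<open>b\<close> go through.\<close>

lemma subring_mult_image:
  fixes \<alpha> :: "'i \<Rightarrow> nat \<Rightarrow> 'a::ring_1" and \<beta> :: "'j \<Rightarrow> nat \<Rightarrow> 'a"
  defines "A \<equiv> int_subalg {\<alpha> i m | i m. True}" and "B \<equiv> int_subalg {\<beta> j n | j n. True}"
  assumes P: "subring P"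
    and P\<alpha>: "\<And>p i m. p \<in> P \<Longrightarrow> p * \<alpha> i m = \<alpha> i m * p"
    and P\<beta>: "\<And>p j n. p \<in> P \<Longrightarrow> p * \<beta> j n = \<beta> j n * p"
    and straight: "\<And>i m j n. \<alpha> i m * \<beta> j n
      \<in> group_closure {b * p * \<alpha> i m' | b p m'. b \<in> B \<and> p \<in> P}"
  shows "subring (mult_image B P A)"
proof -
  let ?M = "mult_image B P A"
  let ?G = "\<lambda>i. {b * p * \<alpha> i m' | b p m'. b \<in> B \<and> p \<in> P}"
  have sA: "subring A" and sB: "subring B"
    by (simp_all add: A_def B_def subring_int_subalg)
  have PA: "p * a = a * p" if "p \<in> P" "a \<in> A" for p a
  proof -
    have "a * p = p * a"
      by (rule int_subalg_commute [OF _ that(2) [unfolded A_def]]) (auto simp: P\<alpha> that(1))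
    then show ?thesis by simp
  qed
  have PB: "p * b = b * p" if "p \<in> P" "b \<in> B" for p b
  proof -
    have "b * p = p * b"
      by (rule int_subalg_commute [OF _ that(2) [unfolded B_def]]) (auto simp: P\<beta> that(1))
    then show ?thesis by simp
  qed
  have \<alpha>A: "\<alpha> i m \<in> A" for i m
    unfolding A_def by (rule int_subalg.base) auto
  have step: "\<alpha> i m * b \<in> group_closure (?G i)" if "b \<in> B" for i m b
    using that [unfolded B_def]
  proof (induction b arbitrary: m)
    case one
    have "\<alpha> i m * 1 \<in> ?G i"
      using subring_1 [OF sB] subring_1 [OF P] by force
    then show ?case by (intro group_closure.base) simp
  next
    case (base b)
    then show ?case using straight by blast
  next
    case (diff b b')
    then show ?case by (simp add: right_diff_distrib group_closure.diff)
  next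
    case (mult b b')
    have "1 * (\<alpha> i m * b) * b' \<in> group_closure (?G i)"
    proof (rule group_closure_mult_mem [OF mult.IH(1)])
      fix s assume "s \<in> ?G i"
      then obtain b1 p m' where s: "s = b1 * p * \<alpha> i m'" "b1 \<in> B" "p \<in> P" by auto
      have "b1 * p * (\<alpha> i m' * b') * 1 \<in> group_closure (?G i)"
      proof (rule group_closure_mult_mem [OF mult.IH(2)])
        fix t assume "t \<in> ?G i"
        then obtain b2 q m2 where t: "t = b2 * q * \<alpha> i m2" "b2 \<in> B" "q \<in> P" by auto
        have "b1 * p * t * 1 = (b1 * b2) * (p * q) * \<alpha> i m2"
          using PB [OF s(3) t(2)] by (simp add: t(1) mult.assoc) (metis mult.assoc)
        moreover have "b1 * b2 \<in> B" "p * q \<in> P"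
          using s t subring_mult [OF sB] subring_mult [OF P] by auto
        ultimately show "b1 * p * t * 1 \<in> group_closure (?G i)"
          by (intro group_closure.base) auto
      qed
      then show "1 * s * b' \<in> group_closure (?G i)"
        by (simp add: s(1) mult.assoc)
    qed
    then show ?case by (simp add: mult.assoc)
  qed
  \<comment> \<open>The family index is forgotten here; with any element of \<open>A\<close> allowed
    on the right, products on the left can be treated by associativity.\<close>
  have AB: "\<forall>b\<in>B. a * b \<in> ?M" if "a \<in> A" for a
    using that [unfolded A_def]
  proof induction
    case one
    show ?case
      using mult_image_memI [OF _ subring_1 [OF P] subring_1 [OF sA], of _ B] by simp
  next
    case (base a)
    then obtain i m where a: "a = \<alpha> i m" by auto
    have "?G i \<subseteq> ?M"
      by (auto intro!: mult_image_memI \<alpha>A)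
    then have "group_closure (?G i) \<subseteq> ?M"
      unfolding mult_image_def by (rule group_closure_subset)
    then show ?case using step unfolding a by blast
  next
    case (diff a a')
    then show ?case
      by (simp add: left_diff_distrib mult_image_def group_closure.diff)
  next
    case (mult a a')
    show ?case
    proof
      fix b assume "b \<in> B"
      with mult.IH have *: "a' * b \<in> ?M" by blast
      have "a * (a' * b) * 1 \<in> ?M"
        unfolding mult_image_def
      proof (rule group_closure_mult_mem [OF * [unfolded mult_image_def]])
        fix s assume "s \<in> {a * b * d |a b d. a \<in> B \<and> b \<in> P \<and> d \<in> A}"
        then obtain b1 p d where s: "s = b1 * p * d" "b1 \<in> B" "p \<in> P" "d \<in> A" by auto
        have "1 * (a * b1) * (p * d) \<in> ?M"
          unfolding mult_image_def
        proof (rule group_closure_mult_mem)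
          show "a * b1 \<in> group_closure {a * b * d |a b d. a \<in> B \<and> b \<in> P \<and> d \<in> A}"
            using mult.IH(1) s(2) by (simp add: mult_image_def)
          fix t assume "t \<in> {a * b * d |a b d. a \<in> B \<and> b \<in> P \<and> d \<in> A}"
          then obtain b2 q e where t: "t = b2 * q * e" "b2 \<in> B" "q \<in> P" "e \<in> A" by auto
          have "1 * t * (p * d) = b2 * (q * p) * (e * d)"
            using PA [OF s(3) t(4)] by (simp add: t(1) mult.assoc) (metis mult.assoc)
          then show "1 * t * (p * d) \<in> group_closure {a * b * d |a b d. a \<in> B \<and> b \<in> P \<and> d \<in> A}"
            using mult_image_memI [OF t(2) subring_mult [OF P t(3) s(3)] subring_mult [OF sA t(4) s(4)]]
            by (simp add: mult_image_def)
        qed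
        then show "a * s * 1 \<in> group_closure {a * b * d |a b d. a \<in> B \<and> b \<in> P \<and> d \<in> A}"
          by (simp add: s(1) mult.assoc mult_image_def)
      qed
      then show "a * a' * b \<in> ?M" by (simp add: mult.assoc)
    qed
  qed
  have 1: "1 \<in> ?M"
    using mult_image_memI [OF subring_1 [OF sB] subring_1 [OF P] subring_1 [OF sA]] by simp
  have "x * y \<in> ?M" if x: "x \<in> ?M" and y: "y \<in> ?M" for x y
  proof -
    have "1 * x * y \<in> ?M"
      unfolding mult_image_def
    proof (rule group_closure_mult_mem [OF x [unfolded mult_image_def]])
      fix s assume "s \<in> {a * b * d |a b d. a \<in> B \<and> b \<in> P \<and> d \<in> A}"
      then obtain b1 p d where s: "s = b1 * p * d" "b1 \<in> B" "p \<in> P" "d \<in> A" by auto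
      have "s * y * 1 \<in> ?M"
        unfolding mult_image_def
      proof (rule group_closure_mult_mem [OF y [unfolded mult_image_def]])
        fix t assume "t \<in> {a * b * d |a b d. a \<in> B \<and> b \<in> P \<and> d \<in> A}"
        then obtain b2 q e where t: "t = b2 * q * e" "b2 \<in> B" "q \<in> P" "e \<in> A" by auto
        have "b1 * p * (d * b2) * (q * e) \<in> ?M"
          unfolding mult_image_def
        proof (rule group_closure_mult_mem)
          show "d * b2 \<in> group_closure {a * b * d |a b d. a \<in> B \<and> b \<in> P \<and> d \<in> A}"
            using AB [OF s(4)] t(2) by (simp add: mult_image_def)
          fix u assume "u \<in> {a * b * d |a b d. a \<in> B \<and> b \<in> P \<and> d \<in> A}"
          then obtain b3 o3 f where u: "u = b3 * o3 * f" "b3 \<in> B" "o3 \<in> P" "f \<in> A" by auto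
          \<comment> \<open>Only \<open>d * b2\<close> had to be reordered. The middle factors
            \<open>p\<close> and \<open>q\<close> commute with \<open>B\<close> and
            \<open>A\<close>, so they can be gathered around \<open>o3\<close>.\<close>
          have "b1 * p * u * (q * e) = b1 * (p * b3) * o3 * (f * q) * e"
            by (simp add: u(1) mult.assoc)
          also have "\<dots> = (b1 * b3) * (p * o3 * q) * (f * e)"
            by (simp add: PB [OF s(3) u(2)] PA [OF t(3) u(4), symmetric] mult.assoc)
          also have "\<dots> \<in> ?M"
            by (intro mult_image_memI subring_mult [OF sA] subring_mult [OF sB] subring_mult [OF P] s t u)
          finally show "b1 * p * u * (q * e) \<in> group_closure {a * b * d |a b d. a \<in> B \<and> b \<in> P \<and> d \<in> A}"
            by (simp add: mult_image_def)
        qed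
        then show "s * t * 1 \<in> group_closure {a * b * d |a b d. a \<in> B \<and> b \<in> P \<and> d \<in> A}"
          by (simp add: s(1) t(1) mult.assoc mult_image_def)
      qed
      then show "1 * s * y \<in> group_closure {a * b * d |a b d. a \<in> B \<and> b \<in> P \<and> d \<in> A}"
        by (simp add: mult_image_def)
    qed
    then show ?thesis by simp
  qed
  with 1 show ?thesis
    by (auto simp: subring_def) (auto simp: mult_image_def group_closure.diff)
qed

section \<open>Exponential series with coefficients in the enveloping algebra\<close>

lemma of_nat_left_commute: "a * (of_nat k * b) = of_nat k * (a * b)" for a :: "'a::semiring_1"
  by (metis mult.assoc mult_of_nat_commute)

lemma of_int_left_commute: "a * (of_int k * b) = of_int k * (a * b)" for a :: "'a::ring_1"
  by (metis mult.assoc mult_of_int_commute)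

definition euler :: "env fps \<Rightarrow> env fps" where
  "euler F = Abs_fps (\<lambda>n. of_nat n * F $ n)"

lemma euler_nth [simp]: "euler F $ n = of_nat n * F $ n"
  by (simp add: euler_def)

lemma euler_add: "euler (F + G) = euler F + euler G"
  by (simp add: fps_eq_iff algebra_simps)

lemma euler_diff: "euler (F - G) = euler F - euler G"
  by (simp add: fps_eq_iff algebra_simps)

lemma euler_mult: "euler (F * G) = euler F * G + F * euler G"
proof (rule fps_ext)
  fix n
  have "euler (F * G) $ n = (\<Sum>i=0..n. of_nat n * (F $ i * G $ (n - i)))"
    by (simp add: fps_mult_nth sum_distrib_left)
  also have "\<dots> = (\<Sum>i=0..n. of_nat i * F $ i * G $ (n - i) + F $ i * (of_nat (n - i) * G $ (n - i)))"
  proof (rule sum.cong)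
    fix i assume "i \<in> {0..n}"
    then have "of_nat n = of_nat i + (of_nat (n - i) :: env)"
      by (metis atLeastAtMost_iff le_add_diff_inverse of_nat_add)
    then show "of_nat n * (F $ i * G $ (n - i))
      = of_nat i * F $ i * G $ (n - i) + F $ i * (of_nat (n - i) * G $ (n - i))"
      by (simp only: of_nat_left_commute distrib_right mult.assoc)
  qed simp
  also have "\<dots> = (euler F * G + F * euler G) $ n"
    by (simp add: fps_mult_nth sum.distrib)
  finally show "euler (F * G) $ n = (euler F * G + F * euler G) $ n" .
qed

text \<open>In degree \<open>n > 0\<close> the term \<open>A $ 0 * F $ n\<close> is absent and
  \<open>n\<close> can be cancelled, so the lower coefficients determine \<open>F $ n\<close>. The
  source term \<open>C\<close> accommodates commutators of exponentials.\<close>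

lemma euler_eq_unique:
  assumes F: "euler F = A * F + C" and G: "euler G = A * G + C"
    and A: "A $ 0 = 0" and 0: "F $ 0 = G $ 0"
  shows "F = G"
proof (rule fps_ext)
  fix n show "F $ n = G $ n"
  proof (induction n rule: less_induct)
    case (less n)
    show ?case
    proof (cases "n = 0")
      case False
      have "(A * F) $ n = (A * G) $ n"
        unfolding fps_mult_nth
      proof (rule sum.cong)
        fix i assume "i \<in> {0..n}"
        then show "A $ i * F $ (n - i) = A $ i * G $ (n - i)"
          using A less [of "n - i"] False by (cases "i = 0") auto
      qed simp
      then have "euler F $ n = euler G $ n"
        by (simp add: F G)
      then show ?thesis using False by (simp add: of_nat_mult_env_cancel)
    qed (use 0 in simp)
  qed
qed

lemma fps_commuteI:
  assumes "\<And>i j. F $ i * G $ j = G $ j * F $ i"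
  shows "F * G = G * (F :: env fps)"
proof (rule fps_ext)
  fix n
  have "(F * G) $ n = (\<Sum>i=0..n. G $ (n - i) * F $ i)"
    by (simp add: fps_mult_nth assms)
  also have "\<dots> = (\<Sum>i=0..n. G $ i * F $ (n - i))"
    by (rule sum.reindex_bij_witness [where i = "\<lambda>i. n - i" and j = "\<lambda>i. n - i"]) auto
  finally show "(F * G) $ n = (G * F) $ n"
    by (simp add: fps_mult_nth)
qed

lemma fps_const_commuteI: "(\<And>i. F $ i * b = b * F $ i) \<Longrightarrow> F * fps_const b = fps_const b * F"
  for F :: "env fps"
  by (rule fps_ext) simp

lemma fps_mult_nth_mem:
  assumes "subring T" "\<And>i. F $ i \<in> T" "\<And>i. G $ i \<in> T"
  shows "(F * G) $ n \<in> T"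
  unfolding fps_mult_nth by (intro subring_sum subring_mult assms)

definition fps_pairwise_commute :: "env fps \<Rightarrow> bool" where
  "fps_pairwise_commute f \<longleftrightarrow> (\<forall>i j. f $ i * f $ j = f $ j * f $ i)"

lemma euler_commute: "fps_pairwise_commute f \<Longrightarrow> euler f * f = f * euler f"
  by (intro fps_commuteI) (simp add: fps_pairwise_commute_def mult.assoc of_nat_left_commute)

lemma euler_power:
  assumes "fps_pairwise_commute f"
  shows "euler (f ^ Suc k) = of_nat (Suc k) * (euler f * f ^ k)"
proof (induction k)
  case (Suc k)
  have "f * (euler f * f ^ k) = euler f * f ^ Suc k"
    by (simp add: mult.assoc [symmetric] euler_commute [OF assms])
  moreover have "f * (of_nat (Suc k) * (euler f * f ^ k)) = of_nat (Suc k) * (f * (euler f * f ^ k))"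
    by (rule of_nat_left_commute)
  ultimately have "f * euler (f ^ Suc k) = of_nat (Suc k) * (euler f * f ^ Suc k)"
    by (simp only: Suc)
  then show ?case
    using euler_mult [of f "f ^ Suc k"] by (simp add: distrib_right)
qed simp

text \<open>\<open>f ^ i\<close> starts in degree \<open>i\<close> at the earliest, so the sum may
  be cut off anywhere from \<open>n\<close> on. A free bound \<open>N\<close> lets coefficients of
  different degrees share one range of summation.\<close>

lemma exp_series_nth:
  assumes "f $ 0 = 0" "n \<le> N"
  shows "exp_series f $ n = (\<Sum>i=0..N. scal (1 / fact i) * (f ^ i) $ n)"
  unfolding exp_series_def fps_compose_nth
  by (rule sum.mono_neutral_cong_left)
    (use assms in \<open>auto simp: startsby_zero_power_prefix\<close>)

lemma exp_series_nth_0 [simp]: "exp_series f $ 0 = 1"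
  by (simp add: exp_series_def fps_compose_nth)

lemma euler_exp_series:
  assumes f: "f $ 0 = 0" and comm: "fps_pairwise_commute f"
  shows "euler (exp_series f) = euler f * exp_series f"
proof (rule fps_ext)
  fix n
  \<comment> \<open>The bound is \<open>Suc n\<close> so that dropping \<open>i = 0\<close> and
    shifting leaves the range up to \<open>n\<close>.\<close>
  have "euler (exp_series f) $ n = (\<Sum>i=0..Suc n. scal (1 / fact i) * euler (f ^ i) $ n)"
    using f by (simp add: exp_series_nth [where N = "Suc n"] sum_distrib_left scal_left_commute
      distrib_left del: sum.atLeast0_atMost_Suc)
  also have "\<dots> = (\<Sum>i=0..n. scal (1 / fact (Suc i)) * euler (f ^ Suc i) $ n)"
    by (subst sum.atLeast0_atMost_Suc_shift) (simp del: power_Suc)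
  also have "\<dots> = (\<Sum>i=0..n. scal (1 / fact i) * (euler f * f ^ i) $ n)"
  proof (rule sum.cong)
    fix i
    have "(of_nat (Suc i) * (euler f * f ^ i)) $ n = scal (of_nat (Suc i)) * (euler f * f ^ i) $ n"
      by (simp add: fps_of_nat [symmetric] scal_of_nat del: of_nat_Suc)
    then show "scal (1 / fact (Suc i)) * euler (f ^ Suc i) $ n = scal (1 / fact i) * (euler f * f ^ i) $ n"
      unfolding euler_power [OF comm] by (simp add: mult_scal_left del: of_nat_Suc)
  qed simp
  also have "\<dots> = (\<Sum>i=0..n. \<Sum>j=0..n. euler f $ j * (scal (1 / fact i) * (f ^ i) $ (n - j)))"
    by (simp add: fps_mult_nth sum_distrib_left scal_left_commute mult.assoc)
  also have "\<dots> = (\<Sum>j=0..n. euler f $ j * (\<Sum>i=0..n. scal (1 / fact i) * (f ^ i) $ (n - j)))"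
    by (subst sum.swap) (simp only: sum_distrib_left)
  also have "\<dots> = (\<Sum>j=0..n. euler f $ j * exp_series f $ (n - j))"
    using f by (simp only: exp_series_nth [where N = n] diff_le_self)
  finally show "euler (exp_series f) $ n = (euler f * exp_series f) $ n"
    by (simp add: fps_mult_nth)
qed

lemma exp_series_eqI:
  assumes "f $ 0 = 0" "fps_pairwise_commute f" "E $ 0 = 1" "euler E = euler f * E"
  shows "exp_series f = E"
  by (rule euler_eq_unique [where A = "euler f" and C = 0])
    (use assms in \<open>simp_all add: euler_exp_series\<close>)

text \<open>Both products with the constant \<open>b\<close> solve the same Euler equation with the
  initial value \<open>b\<close>.\<close>

lemma exp_series_commute:
  assumes "f $ 0 = 0" "\<And>i. f $ i * b = b * f $ i" "fps_pairwise_commute f"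
  shows "exp_series f $ n * b = b * exp_series f $ n"
proof -
  let ?b = "fps_const b"
  have e: "euler f * ?b = ?b * euler f"
    by (rule fps_const_commuteI) (simp add: assms(2) mult.assoc of_nat_left_commute)
  have b: "euler ?b = 0"
    by (simp add: fps_eq_iff)
  have "exp_series f * ?b = ?b * exp_series f"
  proof (rule euler_eq_unique [where A = "euler f" and C = 0])
    show "euler (exp_series f * ?b) = euler f * (exp_series f * ?b) + 0"
      by (simp add: euler_mult euler_exp_series assms b mult.assoc)
    show "euler (?b * exp_series f) = euler f * (?b * exp_series f) + 0"
      by (simp add: euler_mult euler_exp_series assms b mult.assoc [symmetric] e)
  qed simp_all
  then show ?thesis by (simp add: fps_eq_iff)
qed

lemma exp_series_add:
  assumes "f $ 0 = 0" "fps_pairwise_commute f" "g $ 0 = 0" "fps_pairwise_commute g"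
    and fg: "\<And>i j. f $ i * g $ j = g $ j * f $ i"
  shows "exp_series (f + g) = exp_series f * exp_series g"
proof (rule exp_series_eqI)
  show "(f + g) $ 0 = 0" by (simp add: assms)
  show "fps_pairwise_commute (f + g)"
    using assms by (simp add: fps_pairwise_commute_def algebra_simps)
  have "exp_series f * euler g = euler g * exp_series f"
  proof (rule fps_commuteI)
    fix i j
    have "exp_series f $ i * g $ j = g $ j * exp_series f $ i"
      using assms by (intro exp_series_commute) auto
    then show "exp_series f $ i * euler g $ j = euler g $ j * exp_series f $ i"
      by (simp add: mult.assoc of_nat_left_commute)
  qed
  then show "euler (exp_series f * exp_series g) = euler (f + g) * (exp_series f * exp_series g)"
    using assms by (simp add: euler_mult euler_exp_series euler_add distrib_right mult.assoc [symmetric])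
qed simp

text \<open>The constant term of exp f is \<open>1\<close>, so the recursion for the inverse series
  involves no division.\<close>

lemma exp_series_uminus_mem:
  assumes f: "f $ 0 = 0" "fps_pairwise_commute f"
    and T: "subring T" "\<And>n. exp_series f $ n \<in> T"
  shows "exp_series (- f) $ n \<in> T"
proof (induction n rule: less_induct)
  case (less n)
  have c: "fps_pairwise_commute (- f)"
    using f by (simp add: fps_pairwise_commute_def)
  have "exp_series (f + - f) = exp_series f * exp_series (- f)"
    by (rule exp_series_add) (use f c in \<open>auto simp: fps_pairwise_commute_def\<close>)
  moreover have "exp_series (f + - f) = 1"
    by (rule exp_series_eqI) (simp_all add: fps_pairwise_commute_def fps_eq_iff fps_mult_nth)
  ultimately have e: "exp_series f * exp_series (- f) = 1" by simp
  show ?case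
  proof (cases n)
    case (Suc m)
    have "0 = (exp_series f * exp_series (- f)) $ n"
      by (simp add: e Suc)
    also have "\<dots> = exp_series (- f) $ n
        + (\<Sum>i=0..m. exp_series f $ Suc i * exp_series (- f) $ (m - i))"
      unfolding fps_mult_nth Suc by (subst sum.atLeast0_atMost_Suc_shift) simp
    finally have "exp_series (- f) $ n
        = - (\<Sum>i=0..m. exp_series f $ Suc i * exp_series (- f) $ (m - i))"
      by (simp add: eq_neg_iff_add_eq_0)
    also have "\<dots> \<in> T"
      by (intro subring_uminus subring_sum subring_mult T less) (simp add: Suc)
    finally show ?thesis .
  qed (simp add: subring_1 T)
qed

section \<open>Rescaling the variable\<close>

definition twist :: "(nat \<Rightarrow> int) \<Rightarrow> env fps \<Rightarrow> env fps" where
  "twist w F = Abs_fps (\<lambda>n. of_int (w n) * F $ n)"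

lemma twist_nth [simp]: "twist w F $ n = of_int (w n) * F $ n"
  by (simp add: twist_def)

lemma fps_pairwise_commute_scalI:
  assumes "\<And>n. f $ n = scal (q n) * a n" "\<And>m n. a m * a n = a n * a m"
  shows "fps_pairwise_commute f"
  unfolding fps_pairwise_commute_def
proof (intro allI)
  fix i j
  have "f $ i * f $ j = scal (q i * q j) * (a i * a j)" for i j
    by (simp add: assms(1) mult.assoc scal_left_commute [of "a i"] mult_scal_left)
  then show "f $ i * f $ j = f $ j * f $ i"
    by (simp add: assms(2) [of i j] mult.commute)
qed

text \<open>Multiplicativity of \<open>w\<close> is asked only when the first degree lies in the
  support of \<open>f\<close>. This admits the substitution of i u for u, with i^2 = -1, on even
  series, where its weights \<open>(-1) ^ (k div 2)\<close> are integers.\<close>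

lemma exp_series_twist:
  assumes f: "f $ 0 = 0" "fps_pairwise_commute f"
    and w: "w 0 = 1" "\<And>k j. f $ k \<noteq> 0 \<Longrightarrow> w (k + j) = w k * w j"
  shows "exp_series (twist w f) = twist w (exp_series f)"
proof (rule exp_series_eqI)
  have comm: "of_int x * (a :: env) = a * of_int x" for x a
    by (rule mult_of_int_commute)
  show "fps_pairwise_commute (twist w f)"
    unfolding fps_pairwise_commute_def
  proof (intro allI)
    fix i j
    have "twist w f $ i * twist w f $ j = of_int (w i) * of_int (w j) * (f $ i * f $ j)"
      by (simp add: mult.assoc of_int_left_commute [of "f $ i"])
    also have "\<dots> = of_int (w j) * of_int (w i) * (f $ j * f $ i)"
      using f(2) comm [of "w i" "of_int (w j)"] by (simp only: fps_pairwise_commute_def)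
    also have "\<dots> = twist w f $ j * twist w f $ i"
      by (simp add: mult.assoc of_int_left_commute [of "f $ j"])
    finally show "twist w f $ i * twist w f $ j = twist w f $ j * twist w f $ i" .
  qed
  show "euler (twist w (exp_series f)) = euler (twist w f) * twist w (exp_series f)"
  proof (rule fps_ext)
    fix n
    have "euler (twist w (exp_series f)) $ n = of_int (w n) * euler (exp_series f) $ n"
      by (simp add: of_nat_left_commute)
    also have "\<dots> = (\<Sum>i=0..n. of_int (w n) * (of_nat i * f $ i * exp_series f $ (n - i)))"
      by (simp add: euler_exp_series f fps_mult_nth sum_distrib_left del: euler_nth) simp
    also have "\<dots> = (\<Sum>i=0..n. euler (twist w f) $ i * twist w (exp_series f) $ (n - i))"
    proof (rule sum.cong)
      fix i assume i: "i \<in> {0..n}"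
      show "of_int (w n) * (of_nat i * f $ i * exp_series f $ (n - i))
        = euler (twist w f) $ i * twist w (exp_series f) $ (n - i)"
      proof (cases "f $ i = 0")
        case False
        then have "w n = w i * w (n - i)"
          using w(2) [of i "n - i"] i by simp
        then have "of_int (w n) * (of_nat i * f $ i * exp_series f $ (n - i))
          = of_int (w i) * (of_int (w (n - i)) * (of_nat i * f $ i)) * exp_series f $ (n - i)"
          by (simp add: mult.assoc)
        also have "\<dots> = of_nat i * (of_int (w i) * f $ i) * (of_int (w (n - i)) * exp_series f $ (n - i))"
          by (simp only: mult.assoc of_nat_left_commute of_int_left_commute [of "f $ i"])
        finally show ?thesis by simp
      qed simp
    qed simp
    finally show "euler (twist w (exp_series f)) $ n = (euler (twist w f) * twist w (exp_series f)) $ n"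
      by (simp add: fps_mult_nth)
  qed
qed (use f w in simp_all)

lemma euler_sum: "euler (sum F I) = (\<Sum>i\<in>I. euler (F i))"
  by (induction I rule: infinite_finite_induct) (simp_all add: euler_add, simp_all add: fps_eq_iff)

lemma fps_const_X_power_nth: "(fps_const z * fps_X ^ k) $ n = (if n = k then z else (0::env))"
  by (simp add: fps_X_power_iff)

lemma fps_mult_const_X_power_nth:
  "(F * (fps_const z * fps_X ^ k)) $ n = (if n < k then 0 else F $ (n - k) * (z::env))"
  by (simp add: mult.assoc [symmetric] fps_X_power_mult_right_nth)

text \<open>Since \<open>[f, g]\<close> is central, \<open>exp f\<close> and \<open>exp g\<close> commute up to the factor \<open>exp [f, g]\<close>. The
  variables of the two series are independent, so this is proved for series in the first variable
  whose coefficients are series in the second.\<close>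

theorem exp_series_straighten:
  assumes f: "f $ 0 = 0" "fps_pairwise_commute f"
    and g: "g $ 0 = 0" "fps_pairwise_commute g"
    and fg: "\<And>i k. commutator (f $ i) (g $ k) = (if i = k then z $ k else 0)"
    and zf: "\<And>i k. z $ k * f $ i = f $ i * z $ k"
    and zg: "\<And>i k. z $ k * g $ i = g $ i * z $ k"
    and zz: "fps_pairwise_commute z"
  shows "exp_series f $ m * exp_series g $ n
    = (\<Sum>j=0..min m n. exp_series g $ (n - j) * exp_series z $ j * exp_series f $ (m - j))"
proof -
  define E where "E = exp_series f"
  define G where "G = exp_series g"
  define P where "P = exp_series z"
  have z0: "z $ 0 = 0"
    using fg [of 0 0] f(1) by (simp add: commutator_def)
  have eE: "euler E = euler f * E" and eG: "euler G = euler g * G" and eP: "euler P = euler z * P"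
    by (simp_all add: E_def G_def P_def euler_exp_series f g z0 zz)
  have zE: "E $ i * z $ k = z $ k * E $ i" for i k
    unfolding E_def by (rule exp_series_commute) (simp_all add: f zf)
  have zG: "G $ i * z $ k = z $ k * G $ i" for i k
    unfolding G_def by (rule exp_series_commute) (simp_all add: g zg)

  define Z where "Z k = fps_const (z $ k) * fps_X ^ k" for k
  have Zc: "Z k * F = F * Z k" if "\<And>i. F $ i * z $ k = z $ k * F $ i" for F k
    by (rule fps_commuteI) (simp add: Z_def fps_const_X_power_nth that)
  \<comment> \<open>With \<open>?b\<close> the coefficient \<open>g $ k\<close>, the commutator of
    \<open>E\<close> and \<open>?b\<close> and the series \<open>Z k * E\<close> solve the same
    inhomogeneous Euler equation; its source is the commutator of \<open>euler f\<close> and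
    \<open>?b\<close>, times \<open>E\<close>.\<close>
  have Ek: "E $ m * g $ k = g $ k * E $ m + (if m < k then 0 else z $ k * E $ (m - k))" for m k
  proof -
    let ?b = "fps_const (g $ k)"
    have b: "euler ?b = 0" by (simp add: fps_eq_iff)
    have "E * ?b - ?b * E = Z k * E"
    proof (rule euler_eq_unique)
      have fb: "euler f * ?b - ?b * euler f = euler (Z k)"
      proof (rule fps_ext)
        fix n
        have "(euler f * ?b - ?b * euler f) $ n = of_nat n * commutator (f $ n) (g $ k)"
          by (simp add: commutator_def right_diff_distrib mult.assoc of_nat_left_commute)
        then show "(euler f * ?b - ?b * euler f) $ n = euler (Z k) $ n"
          by (simp add: fg Z_def fps_const_X_power_nth)
      qed
      have "euler (E * ?b - ?b * E) = euler f * E * ?b - ?b * euler f * E"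
        by (simp add: euler_diff euler_mult eE b mult.assoc)
      also have "\<dots> = euler f * (E * ?b - ?b * E) + (euler f * ?b - ?b * euler f) * E"
        by (simp add: algebra_simps)
      finally show "euler (E * ?b - ?b * E) = euler f * (E * ?b - ?b * E) + euler (Z k) * E"
        unfolding fb .
      have "Z k * euler f = euler f * Z k"
        by (rule Zc) (simp add: zf mult.assoc of_nat_left_commute)
      then show "euler (Z k * E) = euler f * (Z k * E) + euler (Z k) * E"
        by (simp add: euler_mult eE mult.assoc [symmetric])
      show "(E * ?b - ?b * E) $ 0 = (Z k * E) $ 0"
        by (simp add: E_def Z_def fps_const_X_power_nth z0)
    qed (simp add: f)
    then have "E $ m * g $ k - g $ k * E $ m = (Z k * E) $ m"
      by (simp add: fps_eq_iff)
    also have "Z k * E = E * Z k"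
      by (rule Zc) (simp add: zE)
    finally show ?thesis
      by (simp add: Z_def fps_mult_const_X_power_nth zE algebra_simps)
  qed

  \<comment> \<open>Write v for the outer variable and u for the inner one. Then \<open>E2\<close>
    is exp f(v), the constant \<open>?G\<close> is exp g(u), \<open>P2\<close> is exp z(u v), and
    \<open>Z2\<close> is the image of z(u v) under u d/du, the operator
    \<open>euler2\<close>.\<close>
  define E2 where "E2 = Abs_fps (\<lambda>m. fps_const (E $ m))"
  define P2 where "P2 = Abs_fps (\<lambda>j. fps_const (P $ j) * fps_X ^ j)"
  define Z2 where "Z2 = Abs_fps (\<lambda>k. euler (Z k))"
  define euler2 where "euler2 F = Abs_fps (\<lambda>m. euler (F $ m))" for F
  have euler2_mult: "euler2 (A * B) = euler2 A * B + A * euler2 B" for A B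
    by (rule fps_ext)
      (simp add: euler2_def fps_mult_nth euler_sum euler_mult sum.distrib)
  have euler_const: "euler (fps_const a) = 0" for a
    by (simp add: fps_eq_iff)
  have "euler2 E2 = 0"
    by (rule fps_ext) (simp add: euler2_def E2_def euler_const)
  have Z2_nth: "Z2 $ k $ n = (if n = k then of_nat k * z $ k else 0)" for k n
    by (simp add: Z2_def Z_def fps_const_X_power_nth)
  have Z2c: "Z2 * F = F * Z2" if "\<And>m n k. F $ m $ n * z $ k = z $ k * F $ m $ n" for F
  proof (rule fps_ext)
    fix m
    have "Z2 $ i * F $ j = F $ j * Z2 $ i" for i j
      by (rule fps_commuteI) (simp add: Z2_nth that mult.assoc of_nat_left_commute)
    then have "(Z2 * F) $ m = (\<Sum>i=0..m. F $ (m - i) * Z2 $ i)"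
      by (simp add: fps_mult_nth)
    also have "\<dots> = (\<Sum>i=0..m. F $ i * Z2 $ (m - i))"
      by (rule sum.reindex_bij_witness [where i = "\<lambda>i. m - i" and j = "\<lambda>i. m - i"]) auto
    finally show "(Z2 * F) $ m = (F * Z2) $ m"
      by (simp add: fps_mult_nth)
  qed
  have eP2: "euler2 P2 = Z2 * P2"
  proof (rule fps_ext)
    fix m
    have XX: "fps_const a * fps_X ^ i * (fps_const b * fps_X ^ j)
      = fps_const (a * b) * fps_X ^ (i + j)" for a b :: env and i j
      by (metis (no_types, lifting) fps_const_mult fps_mult_fps_X_power_commute mult.assoc power_add)
    have Z2i: "Z2 $ i = fps_const (of_nat i * z $ i) * fps_X ^ i" for i
      by (rule fps_ext) (simp add: Z2_nth fps_const_X_power_nth)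
    have "euler2 P2 $ m = fps_const (euler P $ m) * fps_X ^ m"
      by (rule fps_ext) (simp add: euler2_def P2_def fps_const_X_power_nth)
    also have "euler P $ m = (\<Sum>i=0..m. of_nat i * z $ i * P $ (m - i))"
      by (simp only: eP fps_mult_nth) simp
    also have "fps_const \<dots> * fps_X ^ m
        = (\<Sum>i=0..m. fps_const (of_nat i * z $ i * P $ (m - i)) * fps_X ^ m)"
      by (rule fps_ext) (simp add: fps_const_X_power_nth fps_sum_nth)
    also have "\<dots> = (\<Sum>i=0..m. Z2 $ i * P2 $ (m - i))"
      by (rule sum.cong) (simp_all add: Z2i P2_def XX)
    finally show "euler2 P2 $ m = (Z2 * P2) $ m"
      by (simp add: fps_mult_nth)
  qed
  let ?G = "fps_const G" and ?g = "fps_const (euler g)"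
  have eG2: "euler2 ?G = ?g * ?G"
    by (rule fps_ext) (simp add: euler2_def eG, simp add: fps_eq_iff)
  \<comment> \<open>This collects \<open>Ek\<close> over all \<open>k\<close>: moving exp f(v) past
    u g'(u) costs the derivative of z(u v).\<close>
  have Eg: "E2 * ?g = ?g * E2 + Z2 * E2"
  proof (rule fps_ext, rule fps_ext)
    fix m n
    have "(Z2 * E2) $ m $ n = (\<Sum>i=0..m. Z2 $ i $ n * E $ (m - i))"
      by (simp add: fps_mult_nth [of Z2] fps_sum_nth E2_def)
    also have "\<dots> = (if m < n then 0 else of_nat n * z $ n * E $ (m - n))"
      by (simp add: Z2_nth if_distrib [of "\<lambda>x. x * _"] cong: if_cong)
    finally show "(E2 * ?g) $ m $ n = (?g * E2 + Z2 * E2) $ m $ n"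
      by (simp add: E2_def of_nat_left_commute Ek mult.assoc distrib_left)
  qed
  have L: "euler2 (E2 * ?G) = ?g * (E2 * ?G) + Z2 * (E2 * ?G)"
  proof -
    have "euler2 (E2 * ?G) = (E2 * ?g) * ?G"
      by (simp only: euler2_mult \<open>euler2 E2 = 0\<close> eG2 mult.assoc mult_zero_left add_0_left)
    then show ?thesis
      by (simp only: Eg distrib_right mult.assoc)
  qed
  have R: "euler2 (?G * P2 * E2) = ?g * (?G * P2 * E2) + Z2 * (?G * P2 * E2)"
  proof -
    have "?G * Z2 = Z2 * ?G"
      by (rule Z2c [symmetric]) (simp add: zG)
    then have "?G * (Z2 * (P2 * E2)) = Z2 * (?G * (P2 * E2))"
      by (simp only: mult.assoc [symmetric])
    then show ?thesis
      by (simp only: euler2_mult \<open>euler2 E2 = 0\<close> eG2 eP2 mult.assoc distrib_right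
        mult_zero_right add_0_right)
  qed
  have E2_nth: "E2 $ m = fps_const (E $ m)" and P2_nth: "P2 $ m = fps_const (P $ m) * fps_X ^ m" for m
    by (simp_all add: E2_def P2_def)
  have nth: "(?G * P2 * E2) $ m $ n
      = (\<Sum>j=0..m. if n < j then 0 else G $ (n - j) * P $ j * E $ (m - j))" for m n
    by (simp add: fps_mult_nth [of "?G * P2"] fps_sum_nth E2_nth P2_nth
      mult.assoc [of ?G, symmetric] fps_mult_const_X_power_nth
      if_distrib [of "\<lambda>x. x * _"] cong: if_cong)
  \<comment> \<open>\<open>Z2\<close> has no outer constant term, so in outer degree
    \<open>m\<close> it contributes a source \<open>C\<close> from lower degrees; what remains is an
    equation in the inner variable with \<open>A = euler g\<close>.\<close>
  have "(E2 * ?G) $ m = (?G * P2 * E2) $ m" for m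
  proof (induction m rule: less_induct)
    case (less m)
    define C where "C = (\<Sum>i=1..m. Z2 $ i * (E2 * ?G) $ (m - i))"
    have Z20: "Z2 $ 0 = 0"
      by (rule fps_ext) (simp add: Z2_nth)
    have "euler ((E2 * ?G) $ m) = (euler2 (E2 * ?G)) $ m"
      by (simp add: euler2_def)
    also have "\<dots> = euler g * (E2 * ?G) $ m + C"
      by (simp only: L fps_add_nth fps_mult_nth [of Z2] C_def)
        (simp add: Z20 sum.atLeast_Suc_atMost mult.assoc)
    finally have 1: "euler ((E2 * ?G) $ m) = euler g * (E2 * ?G) $ m + C" .
    have "euler ((?G * P2 * E2) $ m) = (euler2 (?G * P2 * E2)) $ m"
      by (simp add: euler2_def)
    also have "\<dots> = euler g * (?G * P2 * E2) $ m + (\<Sum>i=0..m. Z2 $ i * (?G * P2 * E2) $ (m - i))"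
      by (simp only: R fps_add_nth fps_mult_nth [of Z2] fps_mult_left_const_nth)
    also have "(\<Sum>i=0..m. Z2 $ i * (?G * P2 * E2) $ (m - i)) = C"
    proof -
      have "C = (\<Sum>i=1..m. Z2 $ i * (?G * P2 * E2) $ (m - i))"
        unfolding C_def
        by (intro sum.cong refl arg_cong2 [where f = "(*)"] less.IH) auto
      then show ?thesis by (simp add: Z20 sum.atLeast_Suc_atMost)
    qed
    finally have 2: "euler ((?G * P2 * E2) $ m) = euler g * (?G * P2 * E2) $ m + C" .
    have "(?G * P2 * E2) $ m $ 0 = (\<Sum>j=0..m. if j = 0 then G $ 0 * P $ 0 * E $ m else 0)"
      unfolding nth by (rule sum.cong) auto
    also have "\<dots> = E $ m"
      by (simp add: G_def P_def)
    finally have 3: "(E2 * ?G) $ m $ 0 = (?G * P2 * E2) $ m $ 0"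
      by (simp add: E2_def, simp add: G_def)
    show ?case
      by (rule euler_eq_unique [OF 1 2 _ 3]) simp
  qed
  then have "E $ m * G $ n = (?G * P2 * E2) $ m $ n"
    by (metis (no_types) E2_def fps_mult_left_const_nth fps_mult_right_const_nth fps_nth_Abs_fps)
  also have "\<dots> = (\<Sum>j=0..m. if n < j then 0 else G $ (n - j) * P $ j * E $ (m - j))"
    by (rule nth)
  also have "\<dots> = (\<Sum>j=0..min m n. G $ (n - j) * P $ j * E $ (m - j))"
    by (rule sum.mono_neutral_cong_right) auto
  finally show ?thesis
    unfolding E_def G_def P_def .
qed

section \<open>Divided powers, binomials and symmetric functions as exponential series\<close>

definition linear_series :: "env \<Rightarrow> env fps" where
  "linear_series a = Abs_fps (\<lambda>n. if n = 1 then a else 0)"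

lemma linear_series_nth [simp]: "linear_series a $ n = (if n = 1 then a else 0)"
  by (simp add: linear_series_def)

lemma of_nat_mult_scal_fact: "of_nat (Suc n) * (scal (1 / fact (Suc n)) * b) = scal (1 / fact n) * b"
proof -
  have "of_nat (Suc n) * (1 / fact (Suc n)) = (1 / fact n :: rat)"
    by (simp del: of_nat_Suc)
  then show ?thesis by (simp only: of_nat_mult_scal)
qed

lemma exp_linear_series: "exp_series (linear_series a) $ k = dpow a k"
proof -
  have "exp_series (linear_series a) = Abs_fps (dpow a)"
  proof (rule exp_series_eqI)
    show "euler (Abs_fps (dpow a)) = euler (linear_series a) * Abs_fps (dpow a)"
    proof (rule fps_ext)
      fix n
      have "(euler (linear_series a) * Abs_fps (dpow a)) $ n
        = (\<Sum>i=0..n. if i = 1 then a * dpow a (n - 1) else 0)"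
        unfolding fps_mult_nth by (rule sum.cong) auto
      also have "\<dots> = of_nat n * dpow a n"
        by (cases n) (simp_all add: dpow_def of_nat_mult_scal_fact scal_left_commute [of a]
          del: of_nat_Suc fact_Suc)
      finally show "euler (Abs_fps (dpow a)) $ n = (euler (linear_series a) * Abs_fps (dpow a)) $ n"
        by simp
    qed
  qed (simp_all add: fps_pairwise_commute_def dpow_def)
  then show ?thesis by simp
qed

lemma dpow_scal: "dpow (scal q * a) k = scal (q ^ k) * dpow a k"
proof -
  have "(scal q * a) ^ k = scal (q ^ k) * a ^ k"
    by (induction k) (simp_all add: scal_mult mult.assoc scal_left_commute [of a])
  then show ?thesis
    by (simp add: dpow_def mult_scal_left mult.commute)
qed

lemma dpow_straighten:
  assumes "commutator a b = z" "z * a = a * z" "z * b = b * z"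
  shows "dpow a m * dpow b n = (\<Sum>j=0..min m n. dpow b (n - j) * dpow z j * dpow a (m - j))"
  using exp_series_straighten [of "linear_series a" "linear_series b" "linear_series z" m n] assms
  by (simp add: exp_linear_series fps_pairwise_commute_def commutator_def)

text \<open>Separating the rational weights from the elements reduces identities between exponents
  to identities between functions of type \<open>nat \<Rightarrow> rat\<close>.\<close>

definition weighted_series :: "(nat \<Rightarrow> rat) \<Rightarrow> (nat \<Rightarrow> env) \<Rightarrow> env fps" where
  "weighted_series q a = Abs_fps (\<lambda>n. scal (q n) * a n)"

lemma weighted_series_nth [simp]: "weighted_series q a $ n = scal (q n) * a n"
  by (simp add: weighted_series_def)

text \<open>In degree \<open>0\<close> the weight is \<open>x / 0 = 0\<close>.\<close>

abbreviation log_series :: "(nat \<Rightarrow> env) \<Rightarrow> env fps" where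
  "log_series \<equiv> weighted_series (\<lambda>r. (-1) ^ (r - Suc 0) / of_nat r)"

lemma Zsym_eq: "Zsym a = int_subalg (range (fps_nth (exp_series (log_series a))))"
proof -
  have "Abs_fps (\<lambda>r. if r = 0 then 0 else scal ((-1) ^ (r - 1) / of_nat r) * a r) = log_series a"
    by (rule fps_ext) simp
  then show ?thesis by (simp add: Zsym_def)
qed

lemma weighted_series_commute:
  "(\<And>r s. a r * a s = a s * a r) \<Longrightarrow> fps_pairwise_commute (weighted_series q a)"
  by (rule fps_pairwise_commute_scalI [where q = q and a = a]) simp_all

lemma scal_mult_commuteI:
  "a * b = b * a \<Longrightarrow> (scal p * a) * (scal q * b) = (scal q * b) * (scal p * a)"
  by (simp add: mult.assoc scal_left_commute [of a] scal_left_commute [of b] mult_scal_left mult.commute)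

text \<open>For a fixed commuting family, the weights vanishing at \<open>0\<close> for which this
  holds form an additive group, stable under suitable integral twists. Integrality is proved below
  by assembling a weight from known ones.\<close>

definition exp_integral :: "env set \<Rightarrow> env fps \<Rightarrow> bool" where
  "exp_integral T f \<longleftrightarrow> (\<forall>n. exp_series f $ n \<in> T)"

context
  fixes a :: "nat \<Rightarrow> env" and T :: "env set"
  assumes comm: "\<And>r s. a r * a s = a s * a r" and T: "subring T"
begin

lemma exp_integral_add:
  assumes "p 0 = 0" "q 0 = 0"
    "exp_integral T (weighted_series p a)" "exp_integral T (weighted_series q a)"
  shows "exp_integral T (weighted_series (\<lambda>n. p n + q n) a)"
proof -
  have "weighted_series (\<lambda>n. p n + q n) a = weighted_series p a + weighted_series q a"
    by (rule fps_ext) (simp add: scal_add distrib_right)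
  moreover have "exp_series (weighted_series p a + weighted_series q a)
      = exp_series (weighted_series p a) * exp_series (weighted_series q a)"
    by (rule exp_series_add) (simp_all add: assms weighted_series_commute comm scal_mult_commuteI)
  ultimately show ?thesis
    using assms T by (auto simp: exp_integral_def intro: fps_mult_nth_mem)
qed

lemma exp_integral_uminus:
  assumes "p 0 = 0" "exp_integral T (weighted_series p a)"
  shows "exp_integral T (weighted_series (\<lambda>n. - p n) a)"
proof -
  have "weighted_series (\<lambda>n. - p n) a = - weighted_series p a"
    by (rule fps_ext) (simp add: scal_minus)
  then show ?thesis
    using assms T exp_series_uminus_mem [of "weighted_series p a"]
    by (auto simp: exp_integral_def weighted_series_commute comm)
qed

lemma exp_integral_twist:
  assumes "p 0 = 0" "exp_integral T (weighted_series p a)"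
    and w: "w 0 = 1" "\<And>k j. p k \<noteq> 0 \<Longrightarrow> w (k + j) = w k * w j"
  shows "exp_integral T (weighted_series (\<lambda>n. of_int (w n) * p n) a)"
proof -
  have "weighted_series (\<lambda>n. of_int (w n) * p n) a = twist w (weighted_series p a)"
    by (rule fps_ext) (simp add: scal_mult scal_of_int mult.assoc)
  moreover have "exp_series (twist w (weighted_series p a)) = twist w (exp_series (weighted_series p a))"
  proof (rule exp_series_twist)
    show "w (k + j) = w k * w j" if "weighted_series p a $ k \<noteq> 0" for k j
      using that w(2) [of k j] by (cases "p k = 0") simp_all
  qed (use assms in \<open>simp_all add: weighted_series_commute comm\<close>)
  ultimately show ?thesis
    using assms T by (auto simp: exp_integral_def intro: subring_mult subring_of_int)
qed

text \<open>With \<open>f\<close> the series \<open>\<Sum> (-1) ^ (r - 1) a\<^sub>r u ^ r / r\<close>, the averages of \<open>f\<close> over the substitutions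
  \<open>u \<mapsto> \<omega> u\<close> with \<open>\<omega>\<^sup>2 = 1\<close> and \<open>\<omega>\<^sup>4 = 1\<close> pick out the even and the \<open>4\<close>-divisible degrees. The
  exponential of four times the latter is the norm of \<open>exp f\<close>, and it accounts for the signs
  \<open>\<epsilon>\<^sub>r\<close>.\<close>

lemma exp_integral_eps:
  assumes "exp_integral T (log_series a)"
  shows "exp_integral T (log_series (\<lambda>r. scal (eps (int r) * 2) * a r))"
proof -
  define p :: "nat \<Rightarrow> rat" where "p = (\<lambda>r. (-1) ^ (r - 1) / of_nat r)"
  define s :: "nat \<Rightarrow> int" where "s n = (-1) ^ n" for n
  define w :: "nat \<Rightarrow> int" where "w n = (if even n then (-1) ^ (n div 2) else 0)" for n
  define p2 where "p2 n = p n + of_int (s n) * p n" for n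
  define p4 where "p4 n = p2 n + of_int (w n) * p2 n" for n
  have p0: "p 0 = 0" by (simp add: p_def)
  have 1: "exp_integral T (weighted_series p a)"
    using assms by (simp add: p_def)
  have 2: "exp_integral T (weighted_series p2 a)"
    unfolding p2_def
    by (intro exp_integral_add exp_integral_twist 1) (simp_all add: p0 s_def power_add)
  have odd: "p2 n = 0" if "odd n" for n
    using that by (simp add: p2_def s_def)
  have 4: "exp_integral T (weighted_series p4 a)"
    unfolding p4_def
  proof (intro exp_integral_add exp_integral_twist 2)
    fix k j assume "p2 k \<noteq> 0"
    then have "even k" using odd by blast
    then obtain l where "k = 2 * l" by blast
    then show "w (k + j) = w k * w j"
      by (simp add: w_def power_add)
  qed (simp_all add: p2_def p0 w_def)
  \<comment> \<open>\<open>p4\<close> is \<open>4 * p\<close> in degrees divisible by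
    \<open>4\<close> and \<open>0\<close> elsewhere, so \<open>2 * p - p4\<close> is
    \<open>2 * p\<close> with its sign reversed exactly there.\<close>
  have "exp_integral T (weighted_series (\<lambda>n. (p n + p n) + - p4 n) a)"
    by (intro exp_integral_add exp_integral_uminus 1 4) (simp_all add: p0 p4_def p2_def)
  moreover have "(p n + p n) + - p4 n = p n * (eps (int n) * 2)" for n
  proof (cases "even n")
    case True
    then have "4 dvd int n \<longleftrightarrow> even (n div 2)" by presburger
    then have "eps (int n) = - of_int (w n)" and "s n = 1"
      using True by (simp_all only: eps_def s_def w_def minus_one_power_iff if_True split: if_split)
        simp
    then show ?thesis
      by (simp add: p4_def p2_def algebra_simps)
  next
    case False
    then have "\<not> 4 dvd int n" by presburger
    then have "eps (int n) = 1" by (simp add: eps_def)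
    with False show ?thesis
      by (simp add: p4_def p2_def s_def w_def)
  qed
  moreover have "log_series (\<lambda>r. scal (eps (int r) * 2) * a r) = weighted_series (\<lambda>n. p n * (eps (int n) * 2)) a"
    by (rule fps_ext) (simp add: p_def mult_scal_left)
  ultimately show ?thesis by simp
qed

end

lemma exp_integral_Zsym: "exp_integral (Zsym a) (log_series a)"
  unfolding Zsym_eq exp_integral_def by (auto intro: int_subalg.base)

lemma Zsym_subset_iff: "subring T \<Longrightarrow> Zsym a \<subseteq> T \<longleftrightarrow> exp_integral T (log_series a)"
proof
  let ?S = "range (fps_nth (exp_series (log_series a)))"
  have "?S \<subseteq> int_subalg ?S"
    by (auto intro: int_subalg.base)
  moreover assume "Zsym a \<subseteq> T"
  ultimately show "exp_integral T (log_series a)"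
    unfolding Zsym_eq exp_integral_def by blast
next
  assume "subring T" "exp_integral T (log_series a)"
  then show "Zsym a \<subseteq> T"
    unfolding Zsym_eq exp_integral_def by (intro int_subalg_least) auto
qed

lemma subring_Zsym: "subring (Zsym a)"
  unfolding Zsym_def by (rule subring_int_subalg)

lemma Zsym_eps_subset:
  assumes "\<And>r s. a r * a s = a s * a r"
  shows "Zsym (\<lambda>r. scal (eps (int r) * 2) * a r) \<subseteq> Zsym a"
  unfolding Zsym_subset_iff [OF subring_Zsym]
  by (rule exp_integral_eps [OF assms subring_Zsym exp_integral_Zsym])

text \<open>The exponential is exp (a log (1 + u)) = (1 + u)^a. Its equation (1 + u) B' = a B
  amounts to the recursion \<open>B_Suc\<close> for binomials.\<close>

lemma exp_log_series_const: "exp_series (log_series (\<lambda>_. a)) $ k = ubinom a k"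
proof -
  define f where "f = log_series (\<lambda>_. a)"
  define B where "B = Abs_fps (ubinom a)"
  have 0: "ubinom a 0 = 1" by (simp add: ubinom_def)
  have B_Suc: "of_nat (Suc n) * ubinom a (Suc n) = (a - of_nat n) * ubinom a n" for n
  proof -
    have comm: "(a - of_nat i) * (a - of_nat j) = (a - of_nat j) * (a - of_nat i)" for i j
      using mult_of_nat_commute [of i "of_nat j :: env"]
      by (simp add: left_diff_distrib right_diff_distrib mult_of_nat_commute [of _ a])
    have "prod_list (map (\<lambda>i. a - of_nat i) [0..<k]) * (a - of_nat n)
        = (a - of_nat n) * prod_list (map (\<lambda>i. a - of_nat i) [0..<k])" for k
    proof (induction k)
      case (Suc k)
      then show ?case
        by (simp add: mult.assoc comm [of k]) (simp add: mult.assoc [symmetric])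
    qed simp
    then show ?thesis
      by (simp add: ubinom_def of_nat_mult_scal_fact scal_left_commute [of "a - of_nat n"]
        del: of_nat_Suc fact_Suc)
  qed
  have f: "f $ 0 = 0" "fps_pairwise_commute f"
    by (simp_all add: f_def weighted_series_commute)
  have "euler f + fps_X * euler f = fps_const a * fps_X"
  proof (rule fps_ext)
    fix n
    have e: "euler f $ k = (if k = 0 then 0 else scal ((-1) ^ (k - 1)) * a)" for k
      by (simp add: f_def of_nat_mult_scal)
    show "(euler f + fps_X * euler f) $ n = (fps_const a * fps_X) $ n"
    proof (cases n rule: nat.exhaust)
      case (Suc m)
      then show ?thesis
        by (cases m) (simp_all add: e scal_minus del: euler_nth)
    qed (simp add: e del: euler_nth)
  qed
  then have "(euler f + fps_X * euler f) * B = fps_const a * (fps_X * B)"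
    by (simp only: mult.assoc)
  moreover have "euler B + fps_X * euler B = fps_const a * (fps_X * B)"
  proof (rule fps_ext)
    fix n
    show "(euler B + fps_X * euler B) $ n = (fps_const a * (fps_X * B)) $ n"
      by (cases n) (simp_all add: B_def B_Suc left_diff_distrib del: of_nat_Suc)
  qed
  ultimately have eq: "(euler B - euler f * B) + fps_X * (euler B - euler f * B) = 0"
    by (simp add: algebra_simps)
  \<comment> \<open>Cancellation of the factor 1 + u, one degree at a time.\<close>
  have "(euler B - euler f * B) $ n = 0" for n
  proof (induction n)
    case (Suc n)
    have "(euler B - euler f * B) $ Suc n + (fps_X * (euler B - euler f * B)) $ Suc n = 0"
      by (simp only: eq fps_add_nth [symmetric] fps_zero_nth)
    then show ?case using Suc by simp
  qed (simp add: f)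
  then have "euler B = euler f * B"
    by (simp add: fps_eq_iff)
  then have "exp_series f = B"
    by (intro exp_series_eqI f) (simp_all add: B_def 0)
  then show ?thesis by (simp add: f_def B_def)
qed

section \<open>Closure properties of integral binomials\<close>

definition binomial_integral :: "env set \<Rightarrow> env \<Rightarrow> bool" where
  "binomial_integral T a \<longleftrightarrow> (\<forall>k. ubinom a k \<in> T)"

lemma exp_integral_log_const: "exp_integral T (log_series (\<lambda>_. a)) \<longleftrightarrow> binomial_integral T a"
  by (simp add: exp_integral_def binomial_integral_def exp_log_series_const)

lemma ubinom_commute: "a * b = b * a \<Longrightarrow> ubinom a k * b = b * ubinom a k"
  unfolding exp_log_series_const [symmetric]
  by (rule exp_series_commute)
    (simp_all add: weighted_series_commute mult.assoc scal_left_commute [of b])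

text \<open>Vandermonde's identity, in the form (1 + u)^(a + b) = (1 + u)^a (1 + u)^b.\<close>

lemma binomial_integral_add:
  assumes "subring T" "a * b = b * a" "binomial_integral T a" "binomial_integral T b"
  shows "binomial_integral T (a + b)"
proof -
  have "log_series (\<lambda>_. a + b) = log_series (\<lambda>_. a) + log_series (\<lambda>_. b)"
    by (rule fps_ext) (simp add: distrib_left)
  moreover have "exp_series (log_series (\<lambda>_. a) + log_series (\<lambda>_. b))
      = exp_series (log_series (\<lambda>_. a)) * exp_series (log_series (\<lambda>_. b))"
    by (rule exp_series_add) (simp_all add: weighted_series_commute assms scal_mult_commuteI)
  ultimately show ?thesis
    using assms unfolding exp_integral_log_const [symmetric] exp_integral_def
    by (auto intro: fps_mult_nth_mem)
qed

lemma binomial_integral_of_nat_mult: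
  assumes "subring T" "binomial_integral T a"
  shows "binomial_integral T (of_nat n * a)"
proof (induction n)
  case 0
  have "ubinom 0 k = (if k = 0 then 1 else 0)" for k
    by (cases k) (simp_all add: ubinom_def upt_rec)
  then show ?case
    using assms by (simp add: binomial_integral_def subring_0 subring_1)
next
  case (Suc n)
  have "a * (of_nat n * a) = (of_nat n * a) * a"
    by (simp only: of_nat_left_commute mult.assoc)
  from binomial_integral_add [OF assms(1) this assms(2) Suc] show ?case
    by (simp add: distrib_right)
qed

lemma subring_Zbin: "subring (Zbin S)"
  unfolding Zbin_def by (rule subring_int_subalg)

lemma binomial_integral_Zbin: "a \<in> S \<Longrightarrow> binomial_integral (Zbin S) a"
  unfolding Zbin_def binomial_integral_def by (auto intro: int_subalg.base)

lemma Zbin_least: "subring T \<Longrightarrow> (\<And>a. a \<in> S \<Longrightarrow> binomial_integral T a) \<Longrightarrow> Zbin S \<subseteq> T"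
  unfolding Zbin_def binomial_integral_def by (intro int_subalg_least) auto

section \<open>The integral forms of the Cartan and of the nilpotent parts\<close>

lemma Zbin_commute:
  assumes "\<And>a. a \<in> S \<Longrightarrow> a * b = b * a" "x \<in> Zbin S"
  shows "x * b = b * x"
  by (rule int_subalg_commute [OF _ assms(2) [unfolded Zbin_def]]) (auto simp: assms(1) ubinom_commute)

lemma dpow_commute: "a * b = b * a \<Longrightarrow> dpow a k * b = b * dpow a k"
  unfolding exp_linear_series [symmetric]
  by (rule exp_series_commute) (simp_all add: fps_pairwise_commute_def)

lemma Zdiv_commute:
  assumes "\<And>a. a \<in> S \<Longrightarrow> a * b = b * a" "x \<in> Zdiv S"
  shows "x * b = b * x"
  by (rule int_subalg_commute [OF _ assms(2) [unfolded Zdiv_def]]) (auto simp: assms(1) dpow_commute)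

lemma hU_eq: "hU r = scal 2 * hh r"
  by (simp add: hh_def mult_scal_left)

lemma two_hh_0: "2 * hh 0 = hU 0"
  by (simp add: hU_eq scal_numeral)

lemma four_c_tilde: "4 * c_tilde = cU"
proof -
  have "scal 4 * c_tilde = cU"
    by (simp add: c_tilde_def mult_scal_left)
  then show ?thesis by (simp add: scal_numeral)
qed

lemma hh_commute: "r + s \<noteq> 0 \<or> r = 0 \<Longrightarrow> hh r * hh s = hh s * hh r"
  using h_h [of r s]
  by (auto simp: hh_def commutator_0_iff split: if_splits intro: scal_mult_commuteI)

text \<open>The sign \<open>k\<close> handles the positive and the negative half of the Heisenberg
  algebra together. Inside one half, opposite indices are both \<open>0\<close>.\<close>

lemma hh_commute_half:
  "k = 1 \<or> k = - 1 \<Longrightarrow> hh (k * int r) * hh (k * int s) = hh (k * int s) * hh (k * int r)"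
  by (rule hh_commute) auto

lemma c_tilde_commute: "c_tilde * hh r = hh r * c_tilde"
  unfolding c_tilde_def hh_def by (rule scal_mult_commuteI) (rule cU_commute_gens)

lemma Zbin_subset: "Zbin {2 * hh 0, 4 * c_tilde} \<subseteq> Zbin {2 * hh 0, c_tilde - hh 0}"
proof -
  define T where "T = Zbin {2 * hh 0, c_tilde - hh 0}"
  have T: "subring T" by (simp add: T_def subring_Zbin)
  have a: "binomial_integral T (2 * hh 0)" and b: "binomial_integral T (c_tilde - hh 0)"
    by (simp_all add: T_def binomial_integral_Zbin)
  have c: "4 * c_tilde = of_nat 2 * (2 * hh 0) + of_nat 4 * (c_tilde - hh 0)"
    by (simp add: algebra_simps)
  have "binomial_integral T (4 * c_tilde)"
    unfolding c
  proof (intro binomial_integral_add binomial_integral_of_nat_mult T a b)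
    have "hh 0 * (c_tilde - hh 0) = (c_tilde - hh 0) * hh 0"
      by (simp add: algebra_simps c_tilde_commute)
    then show "of_nat 2 * (2 * hh 0) * (of_nat 4 * (c_tilde - hh 0))
        = of_nat 4 * (c_tilde - hh 0) * (of_nat 2 * (2 * hh 0))"
      using scal_mult_commuteI [of "hh 0" "c_tilde - hh 0" 4 4]
      by (simp add: scal_numeral mult.assoc [symmetric])
  qed
  then show ?thesis
    using a T unfolding T_def [symmetric] by (intro Zbin_least) auto
qed

text \<open>Moving the two halves of the Cartan part past each other brings in (1 + u)^m and (1 -
  u)^(-2 m) with m = \<open>2 * c_tilde\<close>, so binomials of half of \<open>cU\<close> are
  needed.\<close>

lemma two_c_tilde_binomial_integral: "binomial_integral (Zbin {2 * hh 0, c_tilde - hh 0}) (2 * c_tilde)"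
proof -
  define T where "T = Zbin {2 * hh 0, c_tilde - hh 0}"
  have T: "subring T" by (simp add: T_def subring_Zbin)
  have a: "binomial_integral T (2 * hh 0)" and b: "binomial_integral T (c_tilde - hh 0)"
    by (simp_all add: T_def binomial_integral_Zbin)
  have c: "2 * c_tilde = 2 * hh 0 + of_nat 2 * (c_tilde - hh 0)"
    by (simp add: algebra_simps)
  have "binomial_integral T (2 * c_tilde)"
    unfolding c
  proof (intro binomial_integral_add binomial_integral_of_nat_mult T a b)
    have "hh 0 * (c_tilde - hh 0) = (c_tilde - hh 0) * hh 0"
      by (simp add: algebra_simps c_tilde_commute)
    then show "2 * hh 0 * (of_nat 2 * (c_tilde - hh 0)) = of_nat 2 * (c_tilde - hh 0) * (2 * hh 0)"
      using scal_mult_commuteI [of "hh 0" "c_tilde - hh 0" 2 2]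
      by (simp add: scal_numeral)
  qed
  then show ?thesis by (simp add: T_def)
qed

lemma Zsym_hU_subset:
  assumes "k = 1 \<or> k = - 1"
  shows "Zsym (\<lambda>r. scal (eps (int r)) * hU (k * int r)) \<subseteq> Zsym (\<lambda>r. hh (k * int r))"
proof -
  have "scal (eps (int r)) * hU (k * int r) = scal (eps (int r) * 2) * hh (k * int r)" for r
    by (simp add: hU_eq mult_scal_left)
  then show ?thesis
    using Zsym_eps_subset [of "\<lambda>r. hh (k * int r)"] hh_commute_half [OF assms] by simp
qed

lemma hh_commutator:
  "commutator (hh (int r)) (hh (- int s))
    = (if r = s then scal (2 * of_nat r * (2 + (-1) ^ (r - 1))) * c_tilde else 0)"
proof -
  \<comment> \<open>In degree \<open>0\<close> the truncated exponent has the wrong parity; there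
    the factor \<open>2 * of_nat r\<close> vanishes.\<close>
  have p: "(-1 :: rat) powi (int s - 1) = (-1) ^ (s - Suc 0)" if "s \<noteq> 0"
    using that by (simp add: power_int_def nat_diff_distrib')
  have "commutator (hh (int r)) (hh (- int s)) = scal (1/4) * commutator (hU (int r)) (hU (- int s))"
    by (simp add: hh_def commutator_scal_left commutator_scal_right mult_scal_left)
  also have "\<dots> = (if r = s then scal (2 * of_nat r * (2 + (-1) ^ (r - 1))) * c_tilde else 0)"
    using p by (cases "s = 0") (auto simp: h_h c_tilde_def mult_scal_left)
  finally show ?thesis .
qed

text \<open>The positive and the negative half commute up to multiples of \<open>c_tilde\<close>,
  which commute with both. Straightening therefore yields the factor exp z, and the point is that
  its coefficients lie in \<open>?P\<close>.\<close>

lemma subring_U_ZM_0: "subring U_ZM_0"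
proof -
  let ?P = "Zbin {2 * hh 0, c_tilde - hh 0}"
  define f where "f = log_series (\<lambda>r. hh (int r))"
  define g where "g = log_series (\<lambda>r. hh (- int r))"
  define q :: "nat \<Rightarrow> rat" where "q r = 2 * (2 + (-1) ^ (r - Suc 0)) / of_nat r" for r
  define z where "z = weighted_series q (\<lambda>_. c_tilde)"
  have P: "subring ?P" by (rule subring_Zbin)

  \<comment> \<open>Since \<open>q r = 2 * l r - 4 * (-1) ^ r * l r\<close>, exp z is the product of
    (1 + u)^(2 c~) and (1 - u)^(-4 c~), where c~ is \<open>c_tilde\<close>. Both factors come from
    \<open>2 * c_tilde\<close>, the second by doubling, changing the sign of u, and
    inversion.\<close>
  have z: "exp_integral ?P z"
  proof -
    define l :: "nat \<Rightarrow> rat" where "l = (\<lambda>r. (-1) ^ (r - Suc 0) / of_nat r)"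
    have l0: "l 0 = 0" by (simp add: l_def)
    have 2: "exp_integral ?P (weighted_series (\<lambda>r. l r * 2) (\<lambda>_. c_tilde))"
    proof -
      have "weighted_series (\<lambda>r. l r * 2) (\<lambda>_. c_tilde) = log_series (\<lambda>_. 2 * c_tilde)"
      proof (rule fps_ext)
        fix n
        have "scal (l n * 2) * c_tilde = scal (l n) * (2 * c_tilde)"
          by (metis mult_scal_left scal_numeral)
        then show "weighted_series (\<lambda>r. l r * 2) (\<lambda>_. c_tilde) $ n = log_series (\<lambda>_. 2 * c_tilde) $ n"
          by (simp add: l_def)
      qed
      then show ?thesis
        by (simp only: exp_integral_log_const two_c_tilde_binomial_integral)
    qed
    have 4: "exp_integral ?P (weighted_series (\<lambda>r. (l r * 2) + (l r * 2)) (\<lambda>_. c_tilde))"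
      by (rule exp_integral_add) (use P 2 l0 in simp_all)
    have 5: "exp_integral ?P (weighted_series
        (\<lambda>r. of_int ((-1) ^ r) * ((l r * 2) + (l r * 2))) (\<lambda>_. c_tilde))"
      by (rule exp_integral_twist [where w = "\<lambda>r. (-1) ^ r"]) (use P 4 l0 in \<open>simp_all add: power_add\<close>)
    have 6: "exp_integral ?P (weighted_series
        (\<lambda>r. - (of_int ((-1) ^ r) * ((l r * 2) + (l r * 2)))) (\<lambda>_. c_tilde))"
      by (rule exp_integral_uminus) (use P 5 l0 in simp_all)
    have 7: "exp_integral ?P (weighted_series
        (\<lambda>r. - (of_int ((-1) ^ r) * ((l r * 2) + (l r * 2))) + (l r * 2)) (\<lambda>_. c_tilde))"
      by (rule exp_integral_add) (use P 2 6 l0 in simp_all)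
    have "- (of_int ((-1) ^ r) * ((l r * 2) + (l r * 2))) + (l r * 2) = q r" for r
    proof (cases r)
      case (Suc n)
      then show ?thesis
        by (cases "even n") (simp_all add: l_def q_def field_simps del: of_nat_Suc)
    qed (simp add: l_def q_def)
    with 7 show ?thesis by (simp add: z_def)
  qed

  have straight: "exp_series f $ m * exp_series g $ n
    = (\<Sum>j=0..min m n. exp_series g $ (n - j) * exp_series z $ j * exp_series f $ (m - j))" for m n
  proof (rule exp_series_straighten)
    fix i k
    show "commutator (f $ i) (g $ k) = (if i = k then z $ k else 0)"
    proof (cases "i = k \<and> k \<noteq> 0")
      case True
      \<comment> \<open>The signs of the two logarithmic weights cancel, and 1 / k^2 times 2 k
        leaves 2 / k.\<close>
      have "(-1) ^ (k - Suc 0) / of_nat k * ((-1) ^ (k - Suc 0) / of_nat k * (2 * of_nat k * (2 + (-1) ^ (k - 1))))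
          = (2 * (2 + (-1) ^ (k - Suc 0)) / of_nat k :: rat)"
        using True by (simp add: field_simps minus_one_power_iff)
      then show ?thesis
        using True by (simp add: f_def g_def z_def q_def commutator_scal_left commutator_scal_right
          hh_commutator mult_scal_left)
    qed (auto simp: f_def g_def z_def q_def commutator_scal_left commutator_scal_right hh_commutator)
    show "z $ k * f $ i = f $ i * z $ k" "z $ k * g $ i = g $ i * z $ k"
      by (simp_all add: z_def f_def g_def scal_mult_commuteI c_tilde_commute)
  qed (use hh_commute_half [of 1] hh_commute_half [of "- 1"] in
    \<open>simp_all add: f_def g_def z_def weighted_series_commute\<close>)

  have P_commute: "p * exp_series (log_series (\<lambda>r. hh (k * int r))) $ m
      = exp_series (log_series (\<lambda>r. hh (k * int r))) $ m * p"
    if p: "p \<in> ?P" and k: "k = 1 \<or> k = -1" for p m k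
  proof -
    have "p * hh s = hh s * p" for s
    proof -
      have "a * hh s = hh s * a" if "a \<in> {2 * hh 0, c_tilde - hh 0}" for a
        using that scal_mult_commuteI [of "hh 0" "hh s" 2 1]
        by (auto simp: hh_commute c_tilde_commute left_diff_distrib right_diff_distrib scal_numeral)
      then show ?thesis
        using p by (rule Zbin_commute)
    qed
    then have "exp_series (log_series (\<lambda>r. hh (k * int r))) $ m * p
        = p * exp_series (log_series (\<lambda>r. hh (k * int r))) $ m"
      by (intro exp_series_commute)
        (simp_all add: weighted_series_commute hh_commute_half [OF k] scal_left_commute [of p] mult.assoc)
    then show ?thesis ..
  qed

  \<comment> \<open>The index type is \<open>unit\<close>, since each side is generated by a single
    sequence.\<close>
  have "subring (mult_image (int_subalg {exp_series g $ n |(_::unit) n. True}) ?P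
      (int_subalg {exp_series f $ m |(_::unit) m. True}))"
  proof (rule subring_mult_image [where \<alpha> = "\<lambda>_::unit. fps_nth (exp_series f)"
        and \<beta> = "\<lambda>_::unit. fps_nth (exp_series g)", OF P])
    fix m n
    show "exp_series f $ m * exp_series g $ n \<in> group_closure
      {b * p * exp_series f $ m' |b p m'. b \<in> int_subalg {exp_series g $ n |(_::unit) n. True} \<and> p \<in> ?P}"
      unfolding straight
    proof (intro group_closure_sum group_closure.base insertI2 CollectI exI conjI)
      show "exp_series z $ j \<in> ?P" for j
        using z by (simp add: exp_integral_def)
      show "exp_series g $ j \<in> int_subalg {exp_series g $ n |(_::unit) n. True}" for j
        by (rule int_subalg.base) auto
    qed auto
  qed (use P_commute [of _ 1] P_commute [of _ "-1"] in \<open>simp_all add: f_def g_def\<close>)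
  moreover have "{F $ n |(_::unit) n. True} = range (fps_nth F)" for F :: "env fps"
    by auto
  ultimately show ?thesis
    unfolding U_ZM_0_def Zsym_eq f_def g_def by simp
qed

lemma Zsym_hh_subset_U_ZM_0:
  "Zsym (\<lambda>r. hh (- int r)) \<subseteq> U_ZM_0" "Zsym (\<lambda>r. hh (int r)) \<subseteq> U_ZM_0"
  unfolding U_ZM_0_def
  using mult_image_memI [OF _ subring_1 [OF subring_Zbin] subring_1 [OF subring_Zsym]]
    mult_image_memI [OF subring_1 [OF subring_Zsym] subring_1 [OF subring_Zbin]]
  by (auto simp del: mult_1_left mult_1_right) (metis mult_1_left mult_1_right)+

lemma Zbin_subset_U_ZM_0: "Zbin {2 * hh 0, c_tilde - hh 0} \<subseteq> U_ZM_0"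
  unfolding U_ZM_0_def
  using mult_image_memI [OF subring_1 [OF subring_Zsym] _ subring_1 [OF subring_Zsym]]
  by (metis mult_1_left mult_1_right subsetI)

lemma U_Z_0_subset: "U_Z_0 \<subseteq> U_ZM_0"
proof -
  have "Zbin {hU 0, cU} \<subseteq> Zbin {2 * hh 0, c_tilde - hh 0}"
    using Zbin_subset by (simp only: two_hh_0 four_c_tilde)
  then show ?thesis
    unfolding U_Z_0_def
    using Zsym_hU_subset [of 1] Zsym_hU_subset [of "-1"] Zsym_hh_subset_U_ZM_0 Zbin_subset_U_ZM_0
    by (intro int_subalg_least subring_U_ZM_0) auto
qed

section \<open>The nilpotent parts\<close>

lemma X_odd_eq: "X_odd p r = scal 4 * y_odd p r"
  by (simp add: y_odd_def mult_scal_left)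

lemma X_y_commute:
  "y_odd p r * y_odd p s = y_odd p s * y_odd p r" "xU p r * y_odd p s = y_odd p s * xU p r"
  using X_X [of p r s] x_X [of p r s] unfolding y_odd_def commutator_0_iff
  by (simp_all only: scal_left_commute [of "xU p r"] scal_left_commute [of "X_odd p _"] mult.assoc)

lemma Zdiv_X_subset: "Zdiv (range (X_odd p)) \<subseteq> Zdiv (range (y_odd p))"
proof -
  have "dpow (X_odd p r) k \<in> Zdiv (range (y_odd p))" for r k
  proof -
    have "dpow (X_odd p r) k = of_nat (4 ^ k) * dpow (y_odd p r) k"
      unfolding X_odd_eq dpow_scal by (simp add: scal_of_nat [symmetric])
    moreover have "dpow (y_odd p r) k \<in> Zdiv (range (y_odd p))"
      unfolding Zdiv_def by (rule int_subalg.base) auto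
    ultimately show ?thesis
      unfolding Zdiv_def by (simp only: subring_mult subring_of_nat subring_int_subalg)
  qed
  then show ?thesis
    unfolding Zdiv_def [of "range (X_odd p)"]
    by (intro int_subalg_least) (auto simp: Zdiv_def subring_int_subalg)
qed

text \<open>The bracket of an odd with an even \<open>x\<close> is \<plusminus>4 times some
  \<open>y\<close>, which commutes with every \<open>x\<close> of the same sign. Hence straightening
  puts only integral multiples of divided powers of \<open>y\<close> in the middle.\<close>

lemma subring_U_ZM_pm: "subring (U_ZM_pm p)"
proof -
  let ?P = "Zdiv (range (y_odd p))"
  let ?\<alpha> = "\<lambda>i. dpow (xU p (2 * i + 1))" and ?\<beta> = "\<lambda>j. dpow (xU p (2 * j))"
  have P: "subring ?P" by (simp add: Zdiv_def subring_int_subalg)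
  have Pc: "q * dpow (xU p s) m = dpow (xU p s) m * q" if "q \<in> ?P" for q s m
  proof -
    have "y * dpow (xU p s) m = dpow (xU p s) m * y" if "y \<in> range (y_odd p)" for y
      using that by (auto simp: dpow_commute X_y_commute)
    then show ?thesis
      using that by (rule Zdiv_commute)
  qed
  have "subring (mult_image (int_subalg {?\<beta> j n |j n. True}) ?P (int_subalg {?\<alpha> i m |i m. True}))"
  proof (rule subring_mult_image [OF P])
    fix i j :: int and m n :: nat
    \<comment> \<open>The \<open>4\<close> comes from X = 4 y; the factor (-1)^(2 j) of the relation
      is 1, so only the sign of \<open>p\<close> is left.\<close>
    define q :: int where "q = (case p of Plus \<Rightarrow> 4 | Minus \<Rightarrow> - 4)"
    have "(2 * i + 1 + 2 * j) div 2 = i + j" by presburger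
    then have z: "commutator (xU p (2 * i + 1)) (xU p (2 * j)) = scal (of_int q) * y_odd p (i + j)"
      by (simp add: x_x X_odd_eq mult_scal_left q_def add.commute split: pm.split)
    have "?\<alpha> i m * ?\<beta> j n = (\<Sum>k=0..min m n. dpow (xU p (2 * j)) (n - k)
        * dpow (scal (of_int q) * y_odd p (i + j)) k * dpow (xU p (2 * i + 1)) (m - k))"
      by (rule dpow_straighten [OF z])
        (simp_all add: mult.assoc scal_left_commute [of "xU p _"] X_y_commute)
    also have "\<dots> \<in> group_closure {b * y * ?\<alpha> i m' |b y m'. b \<in> int_subalg {?\<beta> j n |j n. True} \<and> y \<in> ?P}"
    proof (intro group_closure_sum group_closure.base insertI2 CollectI exI conjI)
      fix k
      have "dpow (scal (of_int q) * y_odd p (i + j)) k = of_int (q ^ k) * dpow (y_odd p (i + j)) k"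
        by (simp add: dpow_scal scal_of_int [symmetric])
      also have "\<dots> \<in> ?P"
        by (intro subring_mult subring_of_int P) (auto simp: Zdiv_def intro: int_subalg.base)
      finally show "dpow (scal (of_int q) * y_odd p (i + j)) k \<in> ?P" .
      show "dpow (xU p (2 * j)) (n - k) \<in> int_subalg {?\<beta> j n |j n. True}"
        by (rule int_subalg.base) auto
    qed auto
    finally show "?\<alpha> i m * ?\<beta> j n
      \<in> group_closure {b * y * ?\<alpha> i m' |b y m'. b \<in> int_subalg {?\<beta> j n |j n. True} \<and> y \<in> ?P}" .
  qed (simp_all only: Pc)
  moreover have "{dpow a k |a k. a \<in> range h} = {dpow (h i) k |i k. True}" for h :: "int \<Rightarrow> env"
    by auto
  ultimately show ?thesis
    unfolding U_ZM_pm_def Zdiv_def by simp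
qed

lemma U_Z_pm_subset: "U_Z_pm p \<subseteq> U_ZM_pm p"
proof -
  have Z1: "1 \<in> Zdiv S" and Zb: "a \<in> S \<Longrightarrow> dpow a k \<in> Zdiv S" for S a k
    unfolding Zdiv_def by (auto intro: int_subalg.intros)
  have "dpow (xU p s) k \<in> U_ZM_pm p" for s k
  proof (cases "even s")
    case True
    then obtain r where s: "s = 2 * r" by blast
    have "dpow (xU p s) k * 1 * 1 \<in> U_ZM_pm p"
      unfolding U_ZM_pm_def by (intro mult_image_memI Z1 Zb) (auto simp: s)
    then show ?thesis by simp
  next
    case False
    then obtain r where s: "s = 2 * r + 1" using oddE by blast
    have "1 * 1 * dpow (xU p s) k \<in> U_ZM_pm p"
      unfolding U_ZM_pm_def by (intro mult_image_memI Z1 Zb) (auto simp: s)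
    then show ?thesis by simp
  qed
  then show ?thesis
    unfolding U_Z_pm_def by (intro int_subalg_least subring_U_ZM_pm) auto
qed

lemma y_odd_mem_U_ZM_pm: "y_odd p r \<in> U_ZM_pm p"
proof -
  have "1 * dpow (y_odd p r) 1 * 1 \<in> U_ZM_pm p"
    unfolding U_ZM_pm_def Zdiv_def
    by (intro mult_image_memI int_subalg.one int_subalg.base) auto
  then show ?thesis by (simp add: dpow_def)
qed

section \<open>Root vectors in Mitzman's form\<close>

definition ad_dpow :: "env \<Rightarrow> nat \<Rightarrow> env \<Rightarrow> env" where
  "ad_dpow e n a = scal (1 / fact n) * (commutator e ^^ n) a"

lemma ad_dpow_0 [simp]: "ad_dpow e 0 a = a"
  by (simp add: ad_dpow_def)

lemma ad_dpow_Suc: "of_nat (Suc n) * ad_dpow e (Suc n) a = commutator e (ad_dpow e n a)"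
  unfolding ad_dpow_def of_nat_mult_scal_fact by (simp add: commutator_scal_right)

lemma ad_dpow_eq_0: "ad_dpow e n a = 0 \<Longrightarrow> n \<le> m \<Longrightarrow> ad_dpow e m a = 0"
proof (induction m)
  case (Suc m)
  show ?case
  proof (cases "n = Suc m")
    case False
    with Suc have "ad_dpow e m a = 0" by simp
    then have "of_nat (Suc m) * ad_dpow e (Suc m) a = of_nat (Suc m) * 0"
      by (simp add: ad_dpow_Suc commutator_def del: of_nat_Suc)
    then show ?thesis
      by (subst (asm) of_nat_mult_env_cancel) auto
  qed (use Suc in simp)
qed simp

text \<open>\<open>exp (t e) a exp (- t e) = exp (t ad e) a\<close>.\<close>

lemma ad_dpow_eq_sum: "ad_dpow e n a = (\<Sum>i\<le>n. dpow e i * a * dpow (- e) (n - i))"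
proof -
  let ?E = "exp_series (linear_series e)" and ?F = "exp_series (linear_series (- e))"
  let ?e = "euler (linear_series e)"
  define A where "A = Abs_fps (\<lambda>n. ad_dpow e n a)"
  have le: "fps_pairwise_commute (linear_series e)" "fps_pairwise_commute (linear_series (- e))"
    by (simp_all add: fps_pairwise_commute_def)
  have "A * ?E = ?E * fps_const a"
  proof (rule euler_eq_unique [where A = ?e and C = 0])
    have "euler A = ?e * A - A * ?e"
    proof (rule fps_ext)
      fix n
      have 1: "fps_nth (?e * A) n = (\<Sum>i=0..n. if i = 1 then e * ad_dpow e (n - 1) a else 0)"
        unfolding fps_mult_nth by (rule sum.cong) (auto simp: A_def)
      have 2: "fps_nth (A * ?e) n = (\<Sum>i=0..n. if i = n - 1 \<and> n > 0 then ad_dpow e (n - 1) a * e else 0)"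
        unfolding fps_mult_nth by (rule sum.cong) (auto simp: A_def)
      show "fps_nth (euler A) n = fps_nth (?e * A - A * ?e) n"
        unfolding fps_sub_nth 1 2
        by (cases n) (simp_all add: A_def ad_dpow_Suc commutator_def del: of_nat_Suc)
    qed
    then have "(euler A + A * ?e) * ?E = ?e * A * ?E"
      by simp
    then show "euler (A * ?E) = ?e * (A * ?E) + 0"
      by (simp add: euler_mult euler_exp_series le distrib_right mult.assoc)
    have "euler (fps_const a) = 0"
      by (simp add: fps_eq_iff)
    then show "euler (?E * fps_const a) = ?e * (?E * fps_const a) + 0"
      by (simp add: euler_mult euler_exp_series le mult.assoc)
  qed (simp_all add: A_def)
  have "?E * ?F = 1"
  proof -
    have "exp_series (linear_series e + linear_series (- e)) = ?E * ?F"
      by (rule exp_series_add) (simp_all add: le)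
    moreover have "exp_series (linear_series e + linear_series (- e)) = 1"
      by (rule exp_series_eqI) (simp_all add: fps_pairwise_commute_def fps_eq_iff fps_mult_nth)
    ultimately show ?thesis by simp
  qed
  with \<open>A * ?E = ?E * fps_const a\<close> have "A = ?E * fps_const a * ?F"
    by (metis mult.assoc mult.right_neutral)
  then have "fps_nth A n = (\<Sum>i\<le>n. dpow e i * a * dpow (- e) (n - i))"
    by (simp add: fps_mult_nth [of "?E * fps_const a"] exp_linear_series atLeast0AtMost)
  then show ?thesis by (simp add: A_def)
qed

text \<open>Divided powers of a derivation absorb the binomial coefficients of Leibniz's rule;
  equivalently, exp (t ad e) is multiplicative.\<close>

lemma ad_dpow_mult: "ad_dpow e n (a * b) = (\<Sum>i\<le>n. ad_dpow e i a * ad_dpow e (n - i) b)"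
proof (induction n)
  case (Suc n)
  have comm: "commutator e (x * y) = commutator e x * y + x * commutator e y" for x y
    by (simp add: commutator_def algebra_simps)
  let ?s = "\<lambda>i. ad_dpow e i a" and ?t = "\<lambda>i. ad_dpow e i b"
  have "of_nat (Suc n) * ad_dpow e (Suc n) (a * b) = commutator e (\<Sum>i\<le>n. ?s i * ?t (n - i))"
    by (simp only: ad_dpow_Suc Suc)
  also have "\<dots> = (\<Sum>i\<le>n. commutator e (?s i * ?t (n - i)))"
    by (simp add: commutator_def sum_distrib_left sum_distrib_right sum_subtractf)
  also have "\<dots> = (\<Sum>i\<le>n. of_nat (Suc i) * ?s (Suc i) * ?t (n - i))
      + (\<Sum>i\<le>n. of_nat (Suc (n - i)) * (?s i * ?t (Suc (n - i))))"
    by (simp only: comm ad_dpow_Suc [symmetric] sum.distrib of_nat_left_commute)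
  also have "(\<Sum>i\<le>n. of_nat (Suc i) * ?s (Suc i) * ?t (n - i))
      = (\<Sum>i\<le>Suc n. of_nat i * (?s i * ?t (Suc n - i)))"
    by (subst sum.atMost_Suc_shift) (simp add: mult.assoc del: of_nat_Suc)
  also have "(\<Sum>i\<le>n. of_nat (Suc (n - i)) * (?s i * ?t (Suc (n - i))))
      = (\<Sum>i\<le>Suc n. of_nat (Suc n - i) * (?s i * ?t (Suc n - i)))"
    unfolding sum.atMost_Suc by (simp del: of_nat_Suc of_nat_diff cong: sum.cong)
      (rule sum.cong, simp_all only: Suc_diff_le atMost_iff)
  also have "(\<Sum>i\<le>Suc n. of_nat i * (?s i * ?t (Suc n - i))) + \<dots>
      = (\<Sum>i\<le>Suc n. of_nat (Suc n) * (?s i * ?t (Suc n - i)))"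
    unfolding sum.distrib [symmetric] distrib_right [symmetric] of_nat_add [symmetric]
    by (rule sum.cong) simp_all
  finally have "of_nat (Suc n) * ad_dpow e (Suc n) (a * b)
      = of_nat (Suc n) * (\<Sum>i\<le>Suc n. ?s i * ?t (Suc n - i))"
    by (simp only: sum_distrib_left)
  then show ?case
    by (subst (asm) of_nat_mult_env_cancel) simp_all
qed simp

text \<open>exp (t ad e) is multiplicative and sends \<open>a\<close> to a polynomial in t of degree
  at most \<open>n\<close>, so \<open>a ^ k\<close> goes to one of degree at most
  \<open>n * k\<close> whose coefficient there is a \<open>k\<close>-th power. The induction needs
  the vanishing above \<open>n * k\<close> along with this coefficient.\<close>

lemma ad_dpow_power:
  assumes "ad_dpow e (Suc n) a = 0"
  shows "ad_dpow e (n * k) (a ^ k) = ad_dpow e n a ^ k \<and> (\<forall>m > n * k. ad_dpow e m (a ^ k) = 0)"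
proof (induction k)
  case 0
  have "ad_dpow e (Suc 0) 1 = 0"
    by (simp add: ad_dpow_def commutator_def)
  then show ?case
    by (auto intro: ad_dpow_eq_0)
next
  case (Suc k)
  have z: "ad_dpow e i a = 0" if "i > n" for i
    using ad_dpow_eq_0 [OF assms] that by simp
  have "ad_dpow e (n * Suc k) (a ^ Suc k)
      = (\<Sum>i\<le>n * Suc k. if i = n then ad_dpow e n a * ad_dpow e (n * k) (a ^ k) else 0)"
    unfolding power_Suc ad_dpow_mult
  proof (rule sum.cong)
    fix i assume i: "i \<in> {..n * Suc k}"
    consider "i = n" | "i > n" | "i < n" by linarith
    then show "ad_dpow e i a * ad_dpow e (n * Suc k - i) (a ^ k)
        = (if i = n then ad_dpow e n a * ad_dpow e (n * k) (a ^ k) else 0)"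
    proof cases
      case 3
      then have "n * Suc k - i > n * k" by simp
      with 3 Suc show ?thesis by simp
    qed (use z in auto)
  qed simp
  also have "\<dots> = ad_dpow e n a ^ Suc k"
    using Suc by simp
  finally have 1: "ad_dpow e (n * Suc k) (a ^ Suc k) = ad_dpow e n a ^ Suc k" .
  have "ad_dpow e m (a ^ Suc k) = 0" if m: "m > n * Suc k" for m
    unfolding power_Suc ad_dpow_mult
  proof (rule sum.neutral, rule ballI)
    fix i assume "i \<in> {..m}"
    show "ad_dpow e i a * ad_dpow e (m - i) (a ^ k) = 0"
    proof (cases "i > n")
      case False
      then have "m - i > n * k" using m by simp
      then show ?thesis using Suc by simp
    qed (simp add: z)
  qed
  with 1 show ?case by blast
qed

definition div_integral :: "env set \<Rightarrow> env \<Rightarrow> bool" where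
  "div_integral T a \<longleftrightarrow> (\<forall>k. dpow a k \<in> T)"

lemma div_integral_uminus: "subring T \<Longrightarrow> div_integral T a \<Longrightarrow> div_integral T (- a)"
proof -
  assume "subring T" "div_integral T a"
  moreover have "dpow (- a) k = of_int ((-1) ^ k) * dpow a k" for k
    using dpow_scal [of "- 1" a k] by (simp add: scal_minus scal_of_int [symmetric])
  ultimately show ?thesis
    by (simp only: div_integral_def subring_mult subring_of_int simp_thms)
qed

text \<open>When \<open>e\<close> and \<open>a\<close> are real root vectors and \<open>a\<close> starts its \<open>e\<close>-string, \<open>ad_dpow e n a\<close> is, up to
  sign, the image of \<open>a\<close> under the reflection of \<open>e\<close>. Its divided powers are the top coefficients
  in \<open>t\<close> of \<open>exp (t e) a\<^sup>k exp (- t e) / k!\<close>.\<close>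

lemma div_integral_ad_dpow:
  assumes T: "subring T" and e: "div_integral T e" and a: "div_integral T a"
    and n: "ad_dpow e (Suc n) a = 0"
  shows "div_integral T (ad_dpow e n a)"
  unfolding div_integral_def
proof
  fix k
  have "dpow (ad_dpow e n a) k = scal (1 / fact k) * ad_dpow e (n * k) (a ^ k)"
    using ad_dpow_power [OF n, of k] by (simp add: dpow_def)
  also have "\<dots> = (\<Sum>i\<le>n * k. dpow e i * dpow a k * dpow (- e) (n * k - i))"
    by (simp add: ad_dpow_eq_sum dpow_def [of a] sum_distrib_left mult.assoc
      scal_left_commute [of "dpow e _"])
  also have "\<dots> \<in> T"
    using e a div_integral_uminus [OF T e] unfolding div_integral_def
    by (intro subring_sum subring_mult T) auto
  finally show "dpow (ad_dpow e n a) k \<in> T" .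
qed

lemma div_integral_commutator:
  assumes "subring T" "div_integral T e" "div_integral T a"
    and "commutator e a = b" "commutator e b = 0"
  shows "div_integral T b"
  using div_integral_ad_dpow [of T e a 1] assms
  by (simp add: ad_dpow_def commutator_scal_right)

section \<open>Explicit root strings\<close>

lemma commutator_y_x:
  "commutator (y_odd p s) (xU (opp p) r) = scal (sgn_pm p * (-1) powi r) * xU p (r + (2 * s + 1))"
proof -
  have "commutator (y_odd p s) (xU (opp p) r) = - scal (1/4) * commutator (xU (opp p) r) (X_odd (opp (opp p)) s)"
    by (cases p) (simp_all add: y_odd_def commutator_scal_left commutator_swap [of "X_odd _ _"])
  then show ?thesis
    unfolding x_X_opp by (cases p) (simp_all add: mult_scal_left scal_minus [symmetric])
qed

text \<open>These are successive steps of the string of \<open>xU p 0\<close> that runs from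
  \<open>y_odd (opp p)\<close> to \<open>y_odd p\<close> through \<open>xU (opp p)\<close>,
  \<open>hU\<close> and \<open>xU p\<close>. The \<open>6\<close> is 2 (2 + 1), the value for odd
  indices.\<close>

lemma commutator_x_0_odd:
  assumes "odd s"
  shows "commutator (xU p 0) (xU (opp p) s) = scal (sgn_pm p) * hU s"
    and "commutator (xU p 0) (hU s) = scal (- 6 * sgn_pm p) * xU p s"
    and "commutator (xU p 0) (xU p s) = scal (- 4 * sgn_pm p) * y_odd p (s div 2)"
proof -
  have "s \<noteq> 0" using assms by auto
  then show "commutator (xU p 0) (xU (opp p) s) = scal (sgn_pm p) * hU s"
    using x_x_opp [of 0 s] x_x_opp [of s 0]
    by (cases p) (simp_all add: commutator_swap [of "xU Minus _"] scal_minus)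
  show "commutator (xU p 0) (hU s) = scal (- 6 * sgn_pm p) * xU p s"
    using h_x [of s p 0] assms
    by (simp add: commutator_swap [of "xU _ _"] scal_minus mult.commute)
  show "commutator (xU p 0) (xU p s) = scal (- 4 * sgn_pm p) * y_odd p (s div 2)"
    using x_x [of p 0 s] assms by (simp add: X_odd_eq mult_scal_left mult.commute)
qed

text \<open>Up to signs that cancel, the constants of the four steps are 1, 1, 6 and 4, with product
  4!; so the divided power of order \<open>4\<close> gives \<open>y_odd p r\<close> itself.\<close>

lemma div_integral_y_opp:
  assumes T: "subring T" and x: "div_integral T (xU p 0)" and y: "div_integral T (y_odd (opp p) r)"
  shows "div_integral T (y_odd p r)"
proof -
  let ?e = "xU p 0" and ?s = "2 * r + 1"
  have s: "odd ?s" "?s div 2 = r" by simp_all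
  have sgn: "sgn_pm p * sgn_pm p = 1" by (cases p) simp_all
  have 1: "commutator ?e (y_odd (opp p) r) = scal (sgn_pm p) * xU (opp p) ?s"
    by (simp add: y_odd_def commutator_scal_right x_X_opp mult_scal_left)
  have 2: "(commutator ?e ^^ 2) (y_odd (opp p) r) = hU ?s"
    by (simp add: numeral_2_eq_2 1 commutator_scal_right commutator_x_0_odd [OF s(1)] mult_scal_left sgn)
  have 4: "(commutator ?e ^^ 4) (y_odd (opp p) r) = scal 24 * y_odd p r"
  proof -
    have "(commutator ?e ^^ 4) (y_odd (opp p) r) = commutator ?e (commutator ?e (hU ?s))"
      by (simp add: 2 [symmetric] eval_nat_numeral)
    then show ?thesis
      by (simp only: commutator_scal_right commutator_x_0_odd [OF s(1)] mult_scal_left s)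
        (simp add: sgn algebra_simps, simp add: mult.assoc [symmetric] sgn)
  qed
  have "ad_dpow ?e 4 (y_odd (opp p) r) = y_odd p r"
    unfolding ad_dpow_def 4 by (simp add: mult_scal_left fact_numeral)
  moreover have "ad_dpow ?e (Suc 4) (y_odd (opp p) r) = 0"
    unfolding ad_dpow_def funpow.simps o_apply 4
    by (simp add: y_odd_def commutator_scal_right x_X)
  ultimately show ?thesis
    using div_integral_ad_dpow [OF T x y, of 4] by simp
qed

text \<open>Two steps of the string change the sign of the root with constant -2, hence -1 after
  division by 2!. The indices add up as 2 (2 r + 1) + (2 s + 1) = 2 (2 r + s + 1) + 1.\<close>

lemma div_integral_y_shift:
  assumes T: "subring T" and e: "div_integral T (y_odd p r)" and y: "div_integral T (y_odd (opp p) s)"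
  shows "div_integral T (y_odd p (2 * r + s + 1))"
proof -
  let ?e = "y_odd p r"
  have hc: "commutator (y_odd p r) (hU (2 * n)) = scal (- 4 * sgn_pm p) * y_odd p (n + r)" for n r
    using h_X [of "2 * n" p r]
    by (simp add: y_odd_def commutator_scal_left commutator_swap [of "X_odd _ _"] mult_scal_left
        scal_minus mult.commute)
  have cc: "commutator (y_odd p r) (scal q * cU) = 0" for r q
    using cU_commute_gens(3) [of p r]
    by (simp add: y_odd_def commutator_scal_left commutator_scal_right commutator_0_iff [symmetric]
        commutator_swap [of "X_odd _ _"])
  \<comment> \<open>The next bracket kills the central term, so its coefficient is left
    existential.\<close>
  obtain q where 1: "commutator ?e (y_odd (opp p) s) = scal (sgn_pm p / 2) * hU (2 * (r + s + 1)) + scal q * cU"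
  proof (cases p)
    case Plus
    have "commutator ?e (y_odd (opp p) s) = scal (1/16) * commutator (X_odd Plus r) (X_odd Minus s)"
      by (simp add: Plus y_odd_def commutator_scal_left commutator_scal_right mult_scal_left)
    then show ?thesis
      unfolding X_X_opp
      by (intro that [of "if r + s + 1 = 0 then of_int (2 * r + 1) / 4 else 0"])
        (simp add: Plus distrib_left mult_scal_left del: of_int_add of_int_mult)
  next
    case Minus
    have "commutator ?e (y_odd (opp p) s) = scal (- 1/16) * commutator (X_odd Plus s) (X_odd Minus r)"
      by (simp add: Minus y_odd_def commutator_scal_left commutator_scal_right mult_scal_left
          commutator_swap [of "X_odd Minus _"] scal_minus)
    then show ?thesis
      unfolding X_X_opp
      by (intro that [of "if s + r + 1 = 0 then - of_int (2 * s + 1) / 4 else 0"])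
        (simp add: Minus distrib_left mult_scal_left add.commute [of s] del: of_int_add of_int_mult)
  qed
  have 2: "(commutator ?e ^^ 2) (y_odd (opp p) s) = scal (- 2) * y_odd p (2 * r + s + 1)"
  proof -
    have "r + s + 1 + r = 2 * r + s + 1" by simp
    moreover have "sgn_pm p / 2 * (- 4 * sgn_pm p) = - 2" by (cases p) simp_all
    ultimately show ?thesis
      by (simp add: numeral_2_eq_2 1 commutator_add_right cc commutator_scal_right [of _ _ "hU _"]
          hc mult_scal_left del: distrib_left_numeral) (simp only: add.assoc)
  qed
  have "ad_dpow ?e 2 (y_odd (opp p) s) = - y_odd p (2 * r + s + 1)"
    unfolding ad_dpow_def 2 by (simp add: mult_scal_left scal_minus)
  moreover have "ad_dpow ?e (Suc 2) (y_odd (opp p) s) = 0"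
    unfolding ad_dpow_def funpow.simps o_apply 2
    unfolding commutator_scal_right using X_y_commute(1) [of p r] by (simp add: commutator_def)
  ultimately have "div_integral T (- y_odd p (2 * r + s + 1))"
    using div_integral_ad_dpow [OF T e y, of 2] by simp
  then show ?thesis
    using div_integral_uminus [OF T] by force
qed

lemma div_integral_x_shift:
  assumes T: "subring T" and y: "div_integral T (y_odd p s)" and x: "div_integral T (xU (opp p) r)"
  shows "div_integral T (xU p (r + (2 * s + 1)))"
proof -
  let ?q = "sgn_pm p * (-1) powi r"
  have "commutator (y_odd p s) (scal ?q * xU p (r + (2 * s + 1))) = 0"
    unfolding commutator_scal_right using X_y_commute(2) [of p _ s] by (simp add: commutator_def)
  then have *: "div_integral T (scal ?q * xU p (r + (2 * s + 1)))"
    by (rule div_integral_commutator [OF T y x commutator_y_x])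
  have "?q = 1 \<or> ?q = - 1"
    by (cases p; cases "even r") simp_all
  then show ?thesis
    using * div_integral_uminus [OF T *] by (auto simp: scal_minus)
qed

lemma subring_U_ZM: "subring U_ZM"
  unfolding U_ZM_def by (rule subring_int_subalg)

lemma div_integral_U_ZM_gens:
  "div_integral U_ZM (xU p 0)" "div_integral U_ZM (y_odd Minus 0)" "div_integral U_ZM (y_odd Plus (- 1))"
  unfolding div_integral_def U_ZM_def by (cases p) (auto intro!: int_subalg.base)

text \<open>\<open>div_integral_y_opp\<close> changes the sign at a fixed index. Combined with it, a
  shift by \<open>y_odd Minus 0\<close> raises the argument by one and a shift by
  \<open>y_odd Plus (- 1)\<close> lowers it by one.\<close>

lemma div_integral_y_odd_U_ZM: "div_integral U_ZM (y_odd p r)"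
proof -
  note opp = div_integral_y_opp [OF subring_U_ZM div_integral_U_ZM_gens(1)]
  note shift = div_integral_y_shift [OF subring_U_ZM]
  have both: "div_integral U_ZM (y_odd p r)" if "div_integral U_ZM (y_odd q r)" for p q r
    using that opp [of Plus r] opp [of Minus r] by (cases p; cases q) auto
  have "div_integral U_ZM (y_odd Minus (int n)) \<and> div_integral U_ZM (y_odd Plus (- int n - 1))" for n
  proof (induction n)
    case 0
    then show ?case using div_integral_U_ZM_gens by simp
  next
    case (Suc n)
    have "div_integral U_ZM (y_odd Minus (2 * 0 + int n + 1))"
      by (rule shift) (use Suc both div_integral_U_ZM_gens in auto)
    moreover have "div_integral U_ZM (y_odd Plus (2 * (- 1) + (- int n - 1) + 1))"
      by (rule shift) (use Suc both div_integral_U_ZM_gens in auto)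
    ultimately show ?case by (simp add: algebra_simps)
  qed
  note * = this
  show ?thesis
  proof (cases "r \<ge> 0")
    case True
    then show ?thesis using * [of "nat r"] both by auto
  next
    case False
    then have "- int (nat (- r - 1)) - 1 = r" by simp
    then show ?thesis using * [of "nat (- r - 1)"] both by metis
  qed
qed

lemma U_Z_subset: "U_Z \<subseteq> U_ZM"
proof -
  have shift: "div_integral U_ZM (xU p (r + (2 * s + 1)))" if "div_integral U_ZM (xU (opp p) r)" for p r s
    by (rule div_integral_x_shift [OF subring_U_ZM div_integral_y_odd_U_ZM that])
  have odd: "div_integral U_ZM (xU p (2 * s + 1))" for p s
    using shift [of p 0 s] div_integral_U_ZM_gens(1) by simp
  have "div_integral U_ZM (xU p r)" for p r
  proof (cases "even r")
    case True
    then obtain s where "r = 2 * s" by blast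
    \<comment> \<open>An even index is a sum of two odd ones; two shifts lead from
      \<open>xU p 0\<close> through the opposite sign back to \<open>p\<close>.\<close>
    then show ?thesis
      using shift [OF odd, of p 0 "s - 1"] by simp
  next
    case False
    then show ?thesis using odd oddE by metis
  qed
  then show ?thesis
    unfolding U_Z_def div_integral_def by (intro int_subalg_least subring_U_ZM) auto
qed

section \<open>Representations of the enveloping algebra\<close>

context
  fixes \<rho> :: "'g \<Rightarrow> ('i \<Rightarrow> rat) \<Rightarrow> 'i \<Rightarrow> rat"
  assumes linear: "\<And>g p q \<phi> \<psi>. \<rho> g (\<lambda>i. p * \<phi> i + q * \<psi> i) = (\<lambda>i. p * \<rho> g \<phi> i + q * \<rho> g \<psi> i)"
begin

definition free_act :: "'g free_alg \<Rightarrow> ('i \<Rightarrow> rat) \<Rightarrow> 'i \<Rightarrow> rat" where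
  "free_act f \<phi> i = (\<Sum>w\<in>Poly_Mapping.keys f. Poly_Mapping.lookup f w * foldr \<rho> (letters w) \<phi> i)"

lemma foldr_linear:
  "foldr \<rho> gs (\<lambda>i. p * \<phi> i + q * \<psi> i) = (\<lambda>i. p * foldr \<rho> gs \<phi> i + q * foldr \<rho> gs \<psi> i)"
  by (induction gs) (simp_all add: linear)

lemma free_act_superset:
  assumes "finite S" "Poly_Mapping.keys f \<subseteq> S"
  shows "free_act f \<phi> i = (\<Sum>w\<in>S. Poly_Mapping.lookup f w * foldr \<rho> (letters w) \<phi> i)"
  unfolding free_act_def
  by (rule sum.mono_neutral_left) (use assms in \<open>auto simp: in_keys_iff\<close>)

lemma free_act_add: "free_act (f + g) \<phi> i = free_act f \<phi> i + free_act g \<phi> i"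
proof -
  let ?S = "Poly_Mapping.keys f \<union> Poly_Mapping.keys g"
  have "Poly_Mapping.keys (f + g) \<subseteq> ?S"
    by (auto simp: in_keys_iff lookup_add)
  then show ?thesis
    by (simp add: free_act_superset [of ?S] lookup_add distrib_right sum.distrib)
qed

lemma free_act_single:
  "free_act (Poly_Mapping.single w q) \<phi> i = q * foldr \<rho> (letters w) \<phi> i"
  by (simp add: free_act_superset [of "{w}"])

lemma free_act_0: "free_act 0 \<phi> i = 0"
  by (simp add: free_act_def)

lemma free_act_diff: "free_act (f - g) \<phi> i = free_act f \<phi> i - free_act g \<phi> i"
  using free_act_add [of "f - g" g \<phi> i] by simp

lemma free_act_linear:
  "free_act f (\<lambda>i. p * \<phi> i + q * \<psi> i) = (\<lambda>i. p * free_act f \<phi> i + q * free_act f \<psi> i)"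
  by (simp add: free_act_def fun_eq_iff foldr_linear sum_distrib_left sum.distrib algebra_simps)

lemma free_act_mult: "free_act (f * g) \<phi> = free_act f (free_act g \<phi>)"
proof (induction f rule: free_alg_induct)
  case (single w q)
  show ?case
  proof (induction g rule: free_alg_induct)
    case zero
    show ?case
      using foldr_linear [of "letters w" 0 "\<lambda>_. 0" 0 "\<lambda>_. 0"]
      by (simp add: fun_eq_iff free_act_0 free_act_single)
  next
    case (single v p)
    have "(\<lambda>i. p * foldr \<rho> (letters v) \<phi> i) = (\<lambda>i. p * foldr \<rho> (letters v) \<phi> i + 0 * \<phi> i)"
      by simp
    then have "foldr \<rho> (letters w) (\<lambda>i. p * foldr \<rho> (letters v) \<phi> i)
        = (\<lambda>i. p * foldr \<rho> (letters w) (foldr \<rho> (letters v) \<phi>) i)"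
      by (simp only: foldr_linear) simp
    then show ?case
      by (simp add: fun_eq_iff mult_single free_act_single plus_word_def)
  next
    case (add f g)
    have "free_act (f + g) \<phi> = (\<lambda>i. 1 * free_act f \<phi> i + 1 * free_act g \<phi> i)"
      by (simp add: fun_eq_iff free_act_add)
    then show ?case
      by (simp only: free_act_linear) (simp add: distrib_left fun_eq_iff free_act_add add)
  qed
qed (simp_all add: fun_eq_iff free_act_0 distrib_right free_act_add)

lemma free_act_fscal: "free_act (fscal q) \<phi> i = q * \<phi> i"
  by (simp add: fscal_def free_act_single zero_word_def)

lemma free_act_fgen: "free_act (fgen g) \<phi> = \<rho> g \<phi>"
  by (simp add: fun_eq_iff fgen_def free_act_single)

end

text \<open>\<open>\<phi> (a, b, d, n)\<close> is the coefficient of \<open>x\<^sub>1\<^sup>a x\<^sub>2\<^sup>b x\<^sub>3\<^sup>d t\<^sup>n\<close>. The loop algebra of \<open>sl\<^sub>3\<close> acts by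
  \<open>E\<^sub>i\<^sub>j t\<^sup>r = t\<^sup>r x\<^sub>i \<partial>/\<partial>x\<^sub>j\<close> on such formal sums of monomials with rational exponents, and
  \<open>A\<^sub>2\<^sup>(\<^sup>2\<^sup>)\<close> modulo \<open>c\<close> embeds by \<open>x\<^sub>r\<^sup>+ = (E\<^sub>1\<^sub>2 + (-1)\<^sup>r E\<^sub>2\<^sub>3) t\<^sup>r\<close> and
  \<open>x\<^sub>r\<^sup>- = 2 (E\<^sub>2\<^sub>1 + (-1)\<^sup>r E\<^sub>3\<^sub>2) t\<^sup>r\<close>.\<close>

type_synonym monomial_fun = "rat \<times> rat \<times> rat \<times> int \<Rightarrow> rat"

definition sg :: "int \<Rightarrow> rat" where "sg r = (if even r then 1 else - 1)"

text \<open>The coefficient of the result at a monomial is read off at its source: x_1 d/dx_2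
  carries the exponents \<open>(a - 1, b + 1, d)\<close> to \<open>(a, b, d)\<close> with the factor
  \<open>b + 1\<close>. The brackets of the \<open>x\<close> force 2 t^s E_13 and 8 t^s E_31 for the
  two kinds of \<open>X\<close>.\<close>

fun gen_act :: "gen \<Rightarrow> monomial_fun \<Rightarrow> monomial_fun" where
  "gen_act Gc \<phi> = (\<lambda>_. 0)"
| "gen_act (Gh r) \<phi> = (\<lambda>(a, b, d, n). 2 * ((a - b) + sg r * (b - d)) * \<phi> (a, b, d, n - r))"
| "gen_act (Gx Plus r) \<phi> = (\<lambda>(a, b, d, n).
    (b + 1) * \<phi> (a - 1, b + 1, d, n - r) + sg r * (d + 1) * \<phi> (a, b - 1, d + 1, n - r))"
| "gen_act (Gx Minus r) \<phi> = (\<lambda>(a, b, d, n).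
    2 * ((a + 1) * \<phi> (a + 1, b - 1, d, n - r) + sg r * (b + 1) * \<phi> (a, b + 1, d - 1, n - r)))"
| "gen_act (GXX Plus k) \<phi> = (\<lambda>(a, b, d, n).
    2 * (d + 1) * \<phi> (a - 1, b, d + 1, n - (2 * k + 1)))"
| "gen_act (GXX Minus k) \<phi> = (\<lambda>(a, b, d, n).
    8 * (a + 1) * \<phi> (a + 1, b, d - 1, n - (2 * k + 1)))"

lemma gen_act_linear:
  "gen_act g (\<lambda>i. p * \<phi> i + q * \<psi> i) = (\<lambda>i. p * gen_act g \<phi> i + q * gen_act g \<psi> i)"
  by (cases "(g, \<phi>)" rule: gen_act.cases) (auto simp: fun_eq_iff algebra_simps)

abbreviation "mono_act \<equiv> free_act gen_act"

lemmas mono_act_simps = free_act_add [where \<rho> = gen_act, OF gen_act_linear] free_act_diff [where \<rho> = gen_act, OF gen_act_linear]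
  free_act_mult [where \<rho> = gen_act, OF gen_act_linear] free_act_0 [where \<rho> = gen_act, OF gen_act_linear]
  free_act_fscal [where \<rho> = gen_act, OF gen_act_linear] free_act_fgen [where \<rho> = gen_act, OF gen_act_linear]

text \<open>Once the parities of the indices are fixed, every sign is a constant, and what remains
  is polynomial in the exponents and linear in values of \<open>\<phi>\<close>.\<close>

lemma mono_act_relator:
  assumes "t \<in> relators"
  shows "mono_act t \<phi> (a, b, d, n) = 0"
  using assms
proof cases
  case (c_central g)
  have "gen_act g (\<lambda>_. 0) = (\<lambda>_. 0)"
    using gen_act_linear [of g 0 "\<lambda>_. 0" 0 "\<lambda>_. 0"] by simp
  then show ?thesis
    unfolding c_central by (simp add: commutator_def mono_act_simps)
next
  case (h_h r s)
  show ?thesis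
    unfolding h_h(1) by (simp add: commutator_def mono_act_simps, (simp_all add: algebra_simps)?)
next
  case (h_x r p s)
  show ?thesis
    unfolding h_x(1) by (cases p; cases "even r"; cases "even s")
      (simp_all add: commutator_def mono_act_simps sg_def, (simp_all add: algebra_simps)?)
next
  case (h_X s r p)
  show ?thesis
    unfolding h_X(1) using h_X(2-) by (cases p; cases "even r")
      (simp_all add: commutator_def mono_act_simps sg_def, (simp_all add: algebra_simps)?)
next
  case (x_x p r s)
  show ?thesis
    unfolding x_x(1) by (cases p; cases "even r"; cases "even s")
      (simp_all add: commutator_def mono_act_simps sg_def, (simp_all add: algebra_simps)?)
next
  case (x_X s p r)
  show ?thesis
    unfolding x_X(1) using x_X(2-) by (cases p; cases "even r")
      (simp_all add: commutator_def mono_act_simps sg_def, (simp_all add: algebra_simps)?)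
next
  case (X_X r s p)
  show ?thesis
    unfolding X_X(1) using X_X(2-) by (cases p) (simp_all add: commutator_def mono_act_simps sg_def, (simp_all add: algebra_simps)?)
next
  case (x_x_opp r s)
  show ?thesis
    unfolding x_x_opp(1) by (cases "even r"; cases "even s")
      (simp_all add: commutator_def mono_act_simps sg_def, (simp_all add: algebra_simps)?)
next
  case (x_X_opp s p r)
  show ?thesis
    unfolding x_X_opp(1) using x_X_opp(2-) by (cases p; cases "even r")
      (simp_all add: commutator_def mono_act_simps sg_def, (simp_all add: algebra_simps)?)
next
  case (X_X_opp r s)
  show ?thesis
    unfolding X_X_opp(1) using X_X_opp(2-) by (simp add: commutator_def mono_act_simps sg_def, (simp_all add: algebra_simps)?)
qed

lemma mono_act_rel_ideal:
  assumes "f \<in> rel_ideal"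
  shows "mono_act f \<phi> = (\<lambda>_. 0)"
  using assms unfolding rel_ideal_def
proof (induction f arbitrary: \<phi> rule: group_closure.induct)
  case (base s)
  show ?case
  proof (cases "s = 0")
    case False
    then obtain a t b where s: "s = a * t * b" and t: "t \<in> relators"
      using base by auto
    have "mono_act t \<psi> = (\<lambda>_. 0)" for \<psi>
      using mono_act_relator [OF t] by (auto simp: fun_eq_iff)
    moreover have "mono_act a (\<lambda>_. 0) = (\<lambda>_. 0)"
      using free_act_linear [where \<rho> = gen_act, OF gen_act_linear, of a 0 "\<lambda>_. 0" 0 "\<lambda>_. 0"] by simp
    ultimately show ?thesis
      by (simp add: s mono_act_simps)
  qed (simp add: fun_eq_iff mono_act_simps)
qed (simp add: fun_eq_iff mono_act_simps)

section \<open>Passage to the quotient\<close>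

definition env_act :: "env \<Rightarrow> monomial_fun \<Rightarrow> monomial_fun" where
  "env_act a = mono_act (rep_env a)"

lemma abs_rep_env: "abs_env (rep_env a) = a"
  by (rule Quotient3_abs_rep [OF Quotient3_env])

lemma env_act_abs_env: "env_act (abs_env f) \<phi> = mono_act f \<phi>"
proof -
  have "rep_env (abs_env f) - f \<in> rel_ideal"
    using abs_rep_env [of "abs_env f"] by (simp add: env.abs_eq_iff)
  then have "mono_act (rep_env (abs_env f) - f) \<phi> i = 0" for i
    by (simp add: mono_act_rel_ideal)
  then show ?thesis
    by (simp add: env_act_def fun_eq_iff mono_act_simps)
qed

lemma env_act_mult: "env_act (a * b) \<phi> = env_act a (env_act b \<phi>)"
  using env_act_abs_env [of "rep_env a * rep_env b"]
  by (simp add: abs_env_mult abs_rep_env env_act_def mono_act_simps)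

lemma env_act_diff: "env_act (a - b) \<phi> = (\<lambda>i. env_act a \<phi> i - env_act b \<phi> i)"
  using env_act_abs_env [of "rep_env a - rep_env b"]
  by (simp add: abs_env_diff abs_rep_env env_act_def mono_act_simps fun_eq_iff)

lemma env_act_scal: "env_act (scal q) \<phi> = (\<lambda>i. q * \<phi> i)"
  by (simp add: scal.abs_eq env_act_abs_env mono_act_simps fun_eq_iff)

lemma env_act_ugen: "env_act (ugen g) \<phi> = gen_act g \<phi>"
  by (simp add: ugen.abs_eq env_act_abs_env mono_act_simps)

lemma env_act_0: "env_act 0 \<phi> = (\<lambda>_. 0)"
  using env_act_scal [of 0] by simp

lemma env_act_1: "env_act 1 \<phi> = \<phi>"
  using env_act_scal [of 1] by simp

lemma env_act_uminus: "env_act (- a) \<phi> = (\<lambda>i. - env_act a \<phi> i)"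
  using env_act_diff [of 0 a \<phi>] by (simp add: env_act_0)

lemma env_act_add: "env_act (a + b) \<phi> = (\<lambda>i. env_act a \<phi> i + env_act b \<phi> i)"
  using env_act_diff [of a "- b" \<phi>] by (simp add: env_act_uminus)

lemma env_act_sum: "env_act (sum f I) \<phi> i = (\<Sum>j\<in>I. env_act (f j) \<phi> i)"
  by (induction I rule: infinite_finite_induct) (simp_all add: env_act_0 env_act_add)

lemma env_act_of_nat: "env_act (of_nat n) \<phi> = (\<lambda>i. of_nat n * \<phi> i)"
  using env_act_scal [of "of_nat n"] by (simp add: scal_of_nat)

lemma env_act_power: "env_act (a ^ n) \<phi> = (env_act a ^^ n) \<phi>"
  by (induction n) (simp_all add: env_act_1 env_act_mult)

lemma env_act_gens:
  "env_act cU = gen_act Gc" "env_act (hU r) = gen_act (Gh r)" "env_act (xU p r) = gen_act (Gx p r)"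
  "env_act (X_odd p r) = gen_act (GXX p r)"
  by (simp_all add: fun_eq_iff env_act_ugen cU_def hU_def xU_def X_odd_def)

lemma ubinom_Suc: "of_nat (Suc n) * ubinom a (Suc n) = ubinom a n * (a - of_nat n)"
  unfolding ubinom_def of_nat_mult_scal_fact by (simp add: mult.assoc)

lemma env_act_ubinom:
  assumes "\<And>\<phi>. env_act a \<phi> = (\<lambda>i. z i * \<phi> i)"
  shows "env_act (ubinom a k) \<phi> = (\<lambda>i. (z i gchoose k) * \<phi> i)"
proof (induction k arbitrary: \<phi>)
  case 0
  then show ?case by (simp add: ubinom_def env_act_1)
next
  case (Suc k)
  show ?case
  proof
    fix i
    have "of_nat (Suc k) * env_act (ubinom a (Suc k)) \<phi> i
        = env_act (of_nat (Suc k) * ubinom a (Suc k)) \<phi> i"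
      by (simp only: env_act_mult env_act_of_nat)
    also have "\<dots> = (z i gchoose k) * (z i - of_nat k) * \<phi> i"
      by (simp only: ubinom_Suc) (simp add: env_act_mult env_act_diff assms Suc env_act_of_nat algebra_simps)
    also have "\<dots> = of_nat (Suc k) * ((z i gchoose Suc k) * \<phi> i)"
      using gbinomial_mult_1 [of "z i" k] by (simp add: algebra_simps)
    finally show "env_act (ubinom a (Suc k)) \<phi> i = (z i gchoose Suc k) * \<phi> i"
      by (simp del: of_nat_Suc)
  qed
qed

definition stabilizer :: "monomial_fun set \<Rightarrow> env set" where
  "stabilizer L = {a. \<forall>\<phi>\<in>L. env_act a \<phi> \<in> L}"

lemma subring_stabilizer:
  assumes "\<And>\<phi> \<psi>. \<phi> \<in> L \<Longrightarrow> \<psi> \<in> L \<Longrightarrow> (\<lambda>i. \<phi> i - \<psi> i) \<in> L"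
  shows "subring (stabilizer L)"
  using assms by (simp add: subring_def stabilizer_def env_act_1 env_act_mult env_act_diff)

section \<open>Strictness\<close>

subsection \<open>Binomials\<close>

lemma hU_0_act: "env_act (hU 0) \<phi> = (\<lambda>i. (case i of (a, b, d, n) \<Rightarrow> 2 * (a - d)) * \<phi> i)"
  by (simp add: env_act_gens fun_eq_iff sg_def)

lemma cU_act: "env_act cU \<phi> = (\<lambda>i. 0 * \<phi> i)"
  by (simp add: env_act_gens)

lemma gbinomial_0_1_Ints: "z = 0 \<or> z = 1 \<Longrightarrow> (z :: rat) gchoose k \<in> \<int>"
  using binomial_gbinomial [of 0 k, where 'a = rat] binomial_gbinomial [of 1 k, where 'a = rat]
  by (metis Ints_of_nat of_nat_0 of_nat_1)

text \<open>In integrable representations \<open>c / 4 - h\<^sub>0 / 2\<close> has integral eigenvalues; here the exponents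
  are half-integral, \<open>h\<^sub>0\<close> has eigenvalue \<open>1\<close>, and \<open>c = 0\<close>.\<close>

lemma c_tilde_minus_hh_notin: "c_tilde - hh 0 \<notin> Zbin {hU 0, cU}"
proof
  define i0 :: "rat \<times> rat \<times> rat \<times> int" where "i0 = (1/2, 0, 0, 0)"
  define L where "L = {\<phi> :: monomial_fun. \<phi> i0 \<in> \<int>}"
  have sub: "subring (stabilizer L)"
    by (rule subring_stabilizer) (simp add: L_def)
  have "binomial_integral (stabilizer L) a" if "a \<in> {hU 0, cU}" for a
    using that
    by (auto simp: binomial_integral_def stabilizer_def L_def i0_def
        env_act_ubinom [OF hU_0_act] env_act_ubinom [OF cU_act] gbinomial_0_1_Ints intro!: Ints_mult)
  then have "Zbin {hU 0, cU} \<subseteq> stabilizer L"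
    by (intro Zbin_least sub)
  moreover assume "c_tilde - hh 0 \<in> Zbin {hU 0, cU}"
  ultimately have "env_act (c_tilde - hh 0) (\<lambda>_. 1) i0 \<in> \<int>"
    by (auto simp: stabilizer_def L_def)
  then have "- (1 / 2) \<in> (\<int> :: rat set)"
    by (simp add: env_act_diff c_tilde_def hh_def env_act_mult env_act_scal hU_0_act cU_act i0_def)
  then have "1 / 2 \<in> (\<int> :: rat set)"
    using Ints_minus by fastforce
  then show False by simp
qed

subsection \<open>Symmetric functions\<close>

text \<open>At the exponents \<open>(1/2, 0, 1/2)\<close>, \<open>h\<^sub>r\<close> acts by \<open>2 t\<^sup>r\<close> for odd \<open>r\<close> and by \<open>0\<close> for even \<open>r\<close>, and
  \<open>exp (\<Sum> 2 u ^ r / r) = (1 + u) / (1 - u) = 1 + 2 u + 2 u\<^sup>2 + \<dots>\<close>, the sum being over odd \<open>r\<close>.\<close>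

definition half_lattice :: "monomial_fun set" where
  "half_lattice = {\<phi>. \<phi> (1/2, 0, 1/2, 0) \<in> \<int> \<and> (\<forall>n. n \<noteq> 0 \<longrightarrow> \<phi> (1/2, 0, 1/2, n) / 2 \<in> \<int>)}"

lemma subring_half: "subring (stabilizer half_lattice)"
  by (rule subring_stabilizer) (auto simp: half_lattice_def diff_divide_distrib)

text \<open>For E = (1 + u) / (1 - u) this is u E' = (2 u + 2 u^3 + ...) E, read in degree
  \<open>m\<close>. The induction goes by two because parity must be kept.\<close>

lemma sum_odd_weights:
  fixes e :: "nat \<Rightarrow> rat"
  defines "e \<equiv> \<lambda>m. if m = 0 then 1 else 2"
  shows "(\<Sum>i=0..m. (if odd i then 2 else 0) * e (m - i)) = 2 * of_nat m"
proof (induction m rule: induct_nat_012)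
  case (ge2 m)
  have "(\<Sum>i=0..Suc (Suc m). (if odd i then 2 else 0) * e (Suc (Suc m) - i))
      = 2 * e (Suc m) + (\<Sum>i=0..m. (if odd i then 2 else 0) * e (m - i))"
    by (subst sum.atLeast0_atMost_Suc_shift, subst sum.atLeast0_atMost_Suc_shift) simp
  also have "\<dots> = 2 * of_nat (Suc (Suc m))"
    by (simp only: ge2.IH(1)) (simp add: e_def)
  finally show ?case .
qed (simp_all add: e_def)

lemma exp_series_half_act:
  assumes k: "k = 1 \<or> k = - 1"
  shows "env_act (exp_series (log_series (\<lambda>r. scal (eps (int r)) * hU (k * int r))) $ m) \<phi> (1/2, 0, 1/2, n)
    = (if m = 0 then 1 else 2) * \<phi> (1/2, 0, 1/2, n - k * int m)"
proof (induction m arbitrary: n rule: less_induct)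
  case (less m)
  define f where "f = log_series (\<lambda>r. scal (eps (int r)) * hU (k * int r))"
  define e :: "nat \<Rightarrow> rat" where "e = (\<lambda>m. if m = 0 then 1 else 2)"
  have comm: "hU (k * int r) * hU (k * int s) = hU (k * int s) * hU (k * int r)" for r s
    unfolding hU_eq by (rule scal_mult_commuteI) (rule hh_commute_half [OF k])
  have f: "f $ 0 = 0" "fps_pairwise_commute f"
    by (simp_all add: f_def weighted_series_commute scal_mult_commuteI comm)
  have fi: "env_act (euler f $ i) \<psi> (1/2, 0, 1/2, n)
      = (if odd i then 2 else 0) * \<psi> (1/2, 0, 1/2, n - k * int i)" for i \<psi> n
  proof (cases "odd i")
    case True
    \<comment> \<open>For odd \<open>i\<close> both \<open>eps\<close> and the alternating sign of
      \<open>log_series\<close> are \<open>1\<close>.\<close>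
    then have "\<not> 4 dvd int i" by presburger
    moreover have "even (i - Suc 0)" "i \<noteq> 0" "odd (k * int i)" using True k by (auto simp: odd_pos)
    ultimately show ?thesis
      using True by (simp add: f_def env_act_mult env_act_of_nat env_act_scal env_act_gens eps_def sg_def)
  next
    case False
    \<comment> \<open>For an even index the eigenvalue is 2 (a - d), which vanishes at these
      exponents.\<close>
    then have "even (k * int i)" by simp
    with False show ?thesis
      by (simp add: f_def env_act_mult env_act_of_nat env_act_scal env_act_gens sg_def)
  qed
  show ?case
  proof (cases "m = 0")
    case False
    have "of_nat m * env_act (exp_series f $ m) \<phi> (1/2, 0, 1/2, n)
        = env_act (euler (exp_series f) $ m) \<phi> (1/2, 0, 1/2, n)"
      by (simp add: env_act_mult env_act_of_nat)
    also have "\<dots> = (\<Sum>i=0..m. env_act (euler f $ i) (env_act (exp_series f $ (m - i)) \<phi>) (1/2, 0, 1/2, n))"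
      by (simp only: euler_exp_series [OF f] fps_mult_nth env_act_sum env_act_mult)
    also have "\<dots> = (\<Sum>i=0..m. (if odd i then 2 else 0) * e (m - i) * \<phi> (1/2, 0, 1/2, n - k * int m))"
    proof (rule sum.cong)
      fix i assume i: "i \<in> {0..m}"
      show "env_act (euler f $ i) (env_act (exp_series f $ (m - i)) \<phi>) (1/2, 0, 1/2, n)
          = (if odd i then 2 else 0) * e (m - i) * \<phi> (1/2, 0, 1/2, n - k * int m)"
      proof (cases "odd i")
        case True
        have eq: "n - k * int i - k * int (m - i) = n - k * int m"
          using i by (simp add: of_nat_diff algebra_simps)
        have "m - i < m" using odd_pos [OF True] i by auto
        from less.IH [OF this, of "n - k * int i"]
        have "env_act (exp_series f $ (m - i)) \<phi> (1/2, 0, 1/2, n - k * int i)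
            = e (m - i) * \<phi> (1/2, 0, 1/2, n - k * int m)"
          by (simp only: f_def e_def eq)
        then show ?thesis
          by (simp only: fi mult.assoc)
      qed (simp add: fi del: euler_nth)
    qed simp
    also have "\<dots> = of_nat m * (2 * \<phi> (1/2, 0, 1/2, n - k * int m))"
      by (simp only: sum_distrib_right [symmetric] e_def sum_odd_weights)
    finally show ?thesis
      using False by (simp add: f_def)
  qed (simp add: env_act_1)
qed

text \<open>A coefficient of positive degree doubles the integral values that it shifts, so the
  results are even; the coefficient of degree \<open>0\<close> is the identity.\<close>

lemma Zsym_hU_stabilizes:
  assumes k: "k = 1 \<or> k = - 1"
  shows "Zsym (\<lambda>r. scal (eps (int r)) * hU (k * int r)) \<subseteq> stabilizer half_lattice"
  unfolding Zsym_subset_iff [OF subring_half] exp_integral_def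
proof
  fix m
  have half: "x \<in> \<int>" if "x / 2 \<in> \<int>" for x :: rat
    using Ints_mult [OF Ints_numeral that, of "num.Bit0 num.One"] by simp
  have "\<phi> (1/2, 0, 1/2, n) \<in> \<int>" if "\<phi> \<in> half_lattice" for \<phi> n
    using that half by (cases "n = 0") (auto simp: half_lattice_def)
  then show "exp_series (log_series (\<lambda>r. scal (eps (int r)) * hU (k * int r))) $ m \<in> stabilizer half_lattice"
    by (cases "m = 0") (auto simp: stabilizer_def half_lattice_def exp_series_half_act [OF k] env_act_1)
qed

lemma hh_notin_stabilizer:
  assumes k: "k = 1 \<or> k = - 1"
  shows "hh k \<notin> stabilizer half_lattice"
proof
  \<comment> \<open>\<open>hh k\<close> moves the value \<open>1\<close> from degree
    \<open>0\<close> to degree \<open>k\<close> without doubling it, and there only even values are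
    allowed.\<close>
  define \<phi> :: monomial_fun where "\<phi> = (\<lambda>(a, b, d, n). if n = 0 then 1 else 0)"
  have "\<phi> \<in> half_lattice"
    by (simp add: half_lattice_def \<phi>_def)
  moreover assume "hh k \<in> stabilizer half_lattice"
  ultimately have "env_act (hh k) \<phi> (1/2, 0, 1/2, k) / 2 \<in> \<int>"
    using k by (auto simp: stabilizer_def half_lattice_def)
  moreover have "odd k" using k by auto
  ultimately show False
    by (simp add: hh_def env_act_mult env_act_scal env_act_gens sg_def \<phi>_def)
qed

lemma hh_mem_Zsym: "hh k \<in> Zsym (\<lambda>r. hh (k * int r))"
proof -
  have "exp_series (log_series (\<lambda>r. hh (k * int r))) $ 1 = hh k"
    by (simp add: exp_series_def fps_compose_nth)
  then show ?thesis
    unfolding Zsym_eq by (metis int_subalg.base rangeI)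
qed

lemma Zsym_strict:
  assumes "k = 1 \<or> k = - 1"
  shows "Zsym (\<lambda>r. scal (eps (int r)) * hU (k * int r)) \<subset> Zsym (\<lambda>r. hh (k * int r))"
  using Zsym_hU_subset [OF assms] Zsym_hU_stabilizes [OF assms] hh_notin_stabilizer [OF assms] hh_mem_Zsym
  by blast

text \<open>At the exponents (1/2, 0, 1/2) both \<open>hU 0\<close> and \<open>cU\<close> act by
  \<open>0\<close>, so their binomials act by \<open>0\<close> or \<open>1\<close>, and all three
  generating subalgebras preserve the same lattice.\<close>

lemma U_Z_0_strict: "U_Z_0 \<subset> U_ZM_0"
proof -
  have "binomial_integral (stabilizer half_lattice) a" if "a \<in> {hU 0, cU}" for a
    using that
    by (auto simp: binomial_integral_def stabilizer_def half_lattice_def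
        env_act_ubinom [OF hU_0_act] env_act_ubinom [OF cU_act] gbinomial_0_1_Ints
        simp flip: times_divide_eq_right intro!: Ints_mult)
  then have "Zbin {hU 0, cU} \<subseteq> stabilizer half_lattice"
    by (intro Zbin_least subring_half)
  then have "U_Z_0 \<subseteq> stabilizer half_lattice"
    unfolding U_Z_0_def using Zsym_hU_stabilizes [of 1] Zsym_hU_stabilizes [of "- 1"]
    by (intro int_subalg_least subring_half) auto
  moreover have "hh 1 \<notin> stabilizer half_lattice"
    by (rule hh_notin_stabilizer) simp
  moreover have "hh 1 \<in> U_ZM_0"
    using hh_mem_Zsym [of 1] Zsym_hh_subset_U_ZM_0 by auto
  ultimately show ?thesis
    using U_Z_0_subset by blast
qed

subsection \<open>Root vectors\<close>

text \<open>Restricting to monomials of degree one gives the standard representation of dimension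
  three; \<open>A\<close>, \<open>B\<close> and \<open>D\<close> are its coordinates as functions of
  the loop degree.\<close>

definition linear_fun :: "(int \<Rightarrow> rat) \<Rightarrow> (int \<Rightarrow> rat) \<Rightarrow> (int \<Rightarrow> rat) \<Rightarrow> monomial_fun" where
  "linear_fun A B D = (\<lambda>(a, b, d, n).
    if (a, b, d) = (1, 0, 0) then A n
    else if (a, b, d) = (0, 1, 0) then B n
    else if (a, b, d) = (0, 0, 1) then D n else 0)"

lemma linear_fun_0: "linear_fun (\<lambda>_. 0) (\<lambda>_. 0) (\<lambda>_. 0) = (\<lambda>_. 0)"
  by (simp add: linear_fun_def fun_eq_iff)

lemma linear_fun_diff:
  "(\<lambda>i. linear_fun A B D i - linear_fun A' B' D' i)
    = linear_fun (\<lambda>n. A n - A' n) (\<lambda>n. B n - B' n) (\<lambda>n. D n - D' n)"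
  by (auto simp: linear_fun_def fun_eq_iff)

lemma linear_fun_divide:
  "(\<lambda>i. linear_fun A B D i / q) = linear_fun (\<lambda>n. A n / q) (\<lambda>n. B n / q) (\<lambda>n. D n / q)"
  by (auto simp: linear_fun_def fun_eq_iff)

lemma x_linear_fun:
  "env_act (xU Plus r) (linear_fun A B D)
    = linear_fun (\<lambda>n. B (n - r)) (\<lambda>n. sg r * D (n - r)) (\<lambda>_. 0)"
  "env_act (xU Minus r) (linear_fun A B D)
    = linear_fun (\<lambda>_. 0) (\<lambda>n. 2 * A (n - r)) (\<lambda>n. 2 * (sg r * B (n - r)))"
  by (auto simp: env_act_gens linear_fun_def fun_eq_iff)

lemma X_linear_fun:
  "env_act (X_odd Plus k) (linear_fun A B D)
    = linear_fun (\<lambda>n. 2 * D (n - (2 * k + 1))) (\<lambda>_. 0) (\<lambda>_. 0)"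
  "env_act (X_odd Minus k) (linear_fun A B D)
    = linear_fun (\<lambda>_. 0) (\<lambda>_. 0) (\<lambda>n. 8 * A (n - (2 * k + 1)))"
  by (auto simp: env_act_gens linear_fun_def fun_eq_iff)

text \<open>\<open>(x\<^sub>r\<^sup>+)\<^sup>(\<^sup>2\<^sup>) = (-1)\<^sup>r t\<^sup>2\<^sup>r E\<^sub>1\<^sub>3 / 2\<close> and \<open>y\<^sub>s\<^sup>+ = t\<^sup>s E\<^sub>1\<^sub>3 / 2\<close> differ only in the parity of the
  exponent of \<open>t\<close>, so the lattice has to depend on that parity.\<close>

definition parity_lattice :: "monomial_fun set" where
  "parity_lattice = {linear_fun A B D | A B D. \<forall>n.
    (if even n then 2 * A n \<in> \<int> \<and> D n \<in> \<int> else A n \<in> \<int> \<and> D n / 2 \<in> \<int>) \<and> B n \<in> \<int>}"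

lemma subring_parity: "subring (stabilizer parity_lattice)"
proof (rule subring_stabilizer)
  fix \<phi> \<psi> assume "\<phi> \<in> parity_lattice" "\<psi> \<in> parity_lattice"
  then obtain A B D A' B' D' where
    "\<phi> = linear_fun A B D" "\<psi> = linear_fun A' B' D'"
    "\<forall>n. (if even n then 2 * A n \<in> \<int> \<and> D n \<in> \<int> else A n \<in> \<int> \<and> D n / 2 \<in> \<int>) \<and> B n \<in> \<int>"
    "\<forall>n. (if even n then 2 * A' n \<in> \<int> \<and> D' n \<in> \<int> else A' n \<in> \<int> \<and> D' n / 2 \<in> \<int>) \<and> B' n \<in> \<int>"
    unfolding parity_lattice_def by auto
  then show "(\<lambda>i. \<phi> i - \<psi> i) \<in> parity_lattice"
    unfolding parity_lattice_def linear_fun_diff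
    by (auto simp: linear_fun_diff right_diff_distrib diff_divide_distrib intro!: exI)
qed

lemma parity_lattice_memI:
  assumes "\<And>n. even n \<Longrightarrow> 2 * A n \<in> \<int>" "\<And>n. odd n \<Longrightarrow> A n \<in> \<int>" "\<And>n. B n \<in> \<int>"
    "\<And>n. even n \<Longrightarrow> D n \<in> \<int>" "\<And>n. odd n \<Longrightarrow> D n / 2 \<in> \<int>"
  shows "linear_fun A B D \<in> parity_lattice"
  unfolding parity_lattice_def using assms
  by (intro CollectI exI [of _ A] exI [of _ B] exI [of _ D]) auto

lemma parity_lattice_cases:
  assumes "\<phi> \<in> parity_lattice"
  obtains A B D where "\<phi> = linear_fun A B D"
    "\<And>n. even n \<Longrightarrow> 2 * A n \<in> \<int>" "\<And>n. odd n \<Longrightarrow> A n \<in> \<int>" "\<And>n. B n \<in> \<int>"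
    "\<And>n. even n \<Longrightarrow> D n \<in> \<int>" "\<And>n. odd n \<Longrightarrow> D n / 2 \<in> \<int>"
    "\<And>n. 2 * A n \<in> \<int>" "\<And>n. D n \<in> \<int>"
proof -
  obtain A B D where *: "\<phi> = linear_fun A B D"
    "\<forall>n. (if even n then 2 * A n \<in> \<int> \<and> D n \<in> \<int> else A n \<in> \<int> \<and> D n / 2 \<in> \<int>) \<and> B n \<in> \<int>"
    using assms unfolding parity_lattice_def by auto
  have two: "2 * x \<in> \<int>" if "x \<in> \<int>" for x :: rat
    using that by simp
  have "2 * A n \<in> \<int>" "D n \<in> \<int>" for n
    using *(2) [rule_format, of n] two [of "A n"] two [of "D n / 2"] by (auto split: if_splits)
  with * show thesis by (intro that [of A B D]) (auto split: if_splits)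
qed

lemma sg_mult_Ints: "x \<in> \<int> \<Longrightarrow> sg r * x \<in> \<int>"
  by (simp add: sg_def)

text \<open>The third power of \<open>xU p r\<close> vanishes on linear forms, so
  \<open>k \<le> 2\<close> remains. The second divided power shifts by \<open>r + r\<close>, keeps
  the parity, and sends \<open>D / 2\<close> to \<open>A\<close> or \<open>2 * A\<close> to
  \<open>D\<close> up to sign, as the lattice allows.\<close>

lemma dpow_x_stabilizes: "dpow (xU p r) k \<in> stabilizer parity_lattice"
  unfolding stabilizer_def
proof (intro CollectI ballI)
  fix \<phi> assume "\<phi> \<in> parity_lattice"
  then obtain A B D where \<phi>: "\<phi> = linear_fun A B D" and
    ints: "\<And>n. even n \<Longrightarrow> 2 * A n \<in> \<int>" "\<And>n. odd n \<Longrightarrow> A n \<in> \<int>" "\<And>n. B n \<in> \<int>"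
    "\<And>n. even n \<Longrightarrow> D n \<in> \<int>" "\<And>n. odd n \<Longrightarrow> D n / 2 \<in> \<int>"
    "\<And>n. 2 * A n \<in> \<int>" "\<And>n. D n \<in> \<int>"
    by (rule parity_lattice_cases) blast
  have act: "env_act (dpow (xU p r) k) \<phi> = (\<lambda>i. 1 / fact k * (env_act (xU p r) ^^ k) \<phi> i)"
    by (simp add: dpow_def env_act_mult env_act_scal env_act_power)
  consider "k = 0" | "k = 1" | "k = 2" | j where "k = j + 3"
  proof -
    have "k = 0 \<or> k = 1 \<or> k = 2 \<or> k = (k - 3) + 3" by arith
    then show thesis using that by blast
  qed
  then show "env_act (dpow (xU p r) k) \<phi> \<in> parity_lattice"
  proof cases
    case 1
    then show ?thesis
      using \<open>\<phi> \<in> parity_lattice\<close> by (simp add: dpow_def env_act_1)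
  next
    case 2
    then show ?thesis
      unfolding act by (cases p) (auto simp: \<phi> x_linear_fun ints sg_mult_Ints intro!: parity_lattice_memI)
  next
    case 3
    show ?thesis
    proof (cases p)
      case Plus
      have "env_act (dpow (xU p r) k) \<phi> = linear_fun (\<lambda>n. sg r * (D (n - r - r) / 2)) (\<lambda>_. 0) (\<lambda>_. 0)"
        unfolding act by (simp add: \<phi> 3 Plus numeral_2_eq_2 x_linear_fun linear_fun_divide)
      also have "\<dots> \<in> parity_lattice"
        using ints(7) by (intro parity_lattice_memI) (auto simp: ints sg_def)
      finally show ?thesis .
    next
      case Minus
      have "env_act (dpow (xU p r) k) \<phi> = linear_fun (\<lambda>_. 0) (\<lambda>_. 0) (\<lambda>n. sg r * (2 * A (n - r - r)))"
        unfolding act by (simp add: \<phi> 3 Minus numeral_2_eq_2 x_linear_fun linear_fun_divide ac_simps)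
      also have "\<dots> \<in> parity_lattice"
        by (intro parity_lattice_memI) (auto simp: ints sg_def)
      finally show ?thesis .
    qed
  next
    case (4 j)
    have 3: "(env_act (xU p r) ^^ 3) \<phi> = (\<lambda>_. 0)"
      unfolding \<phi> by (cases p) (simp_all add: numeral_3_eq_3 x_linear_fun linear_fun_0)
    have "(env_act (xU p r) ^^ j) (\<lambda>_. 0) = (\<lambda>_. 0)"
      by (induction j) (simp_all add: linear_fun_0 [symmetric], cases p, simp_all add: x_linear_fun)
    then have "(env_act (xU p r) ^^ k) \<phi> = (\<lambda>_. 0)"
      by (simp only: 4 funpow_add o_apply 3)
    then have "env_act (dpow (xU p r) k) \<phi> = linear_fun (\<lambda>_. 0) (\<lambda>_. 0) (\<lambda>_. 0)"
      by (simp add: act linear_fun_0)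
    then show ?thesis
      by (simp add: parity_lattice_memI)
  qed
qed

text \<open>The square vanishes on linear forms, and for the first power the factor \<open>2\<close>
  or \<open>8\<close> makes up for the change of parity under the odd shift.\<close>

lemma dpow_X_stabilizes: "dpow (X_odd p r) k \<in> stabilizer parity_lattice"
  unfolding stabilizer_def
proof (intro CollectI ballI)
  fix \<phi> assume "\<phi> \<in> parity_lattice"
  then obtain A B D where \<phi>: "\<phi> = linear_fun A B D" and
    ints: "\<And>n. 2 * A n \<in> \<int>" "\<And>n. D n \<in> \<int>"
    by (rule parity_lattice_cases) blast
  have act: "env_act (dpow (X_odd p r) k) \<phi> = (\<lambda>i. 1 / fact k * (env_act (X_odd p r) ^^ k) \<phi> i)"
    by (simp add: dpow_def env_act_mult env_act_scal env_act_power)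
  consider "k = 0" | "k = 1" | j where "k = j + 2"
  proof -
    have "k = 0 \<or> k = 1 \<or> k = (k - 2) + 2" by arith
    then show thesis using that by blast
  qed
  then show "env_act (dpow (X_odd p r) k) \<phi> \<in> parity_lattice"
  proof cases
    case 1
    then show ?thesis
      using \<open>\<phi> \<in> parity_lattice\<close> by (simp add: dpow_def env_act_1)
  next
    case 2
    have "8 * A n \<in> \<int>" "4 * A n \<in> \<int>" for n
      using Ints_mult [OF Ints_numeral ints(1), of "num.Bit0 (num.Bit0 num.One)" n]
        Ints_mult [OF Ints_numeral ints(1), of "num.Bit0 num.One" n] by simp_all
    then show ?thesis
      using 2 unfolding act by (cases p) (auto simp: \<phi> X_linear_fun ints intro!: parity_lattice_memI)
  next
    case (3 j)
    have 2: "(env_act (X_odd p r) ^^ 2) \<phi> = (\<lambda>_. 0)"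
      unfolding \<phi> by (cases p) (simp_all add: numeral_2_eq_2 X_linear_fun linear_fun_0)
    have "(env_act (X_odd p r) ^^ j) (\<lambda>_. 0) = (\<lambda>_. 0)"
      by (induction j) (simp_all add: linear_fun_0 [symmetric], cases p, simp_all add: X_linear_fun)
    then have "(env_act (X_odd p r) ^^ k) \<phi> = (\<lambda>_. 0)"
      by (simp only: 3 funpow_add o_apply 2)
    then have "env_act (dpow (X_odd p r) k) \<phi> = linear_fun (\<lambda>_. 0) (\<lambda>_. 0) (\<lambda>_. 0)"
      by (simp add: act linear_fun_0)
    then show ?thesis
      by (simp add: parity_lattice_memI)
  qed
qed

lemma y_notin_stabilizer: "y_odd p 0 \<notin> stabilizer parity_lattice"
proof
  \<comment> \<open>One vector serves both signs. The shift by \<open>1\<close> turns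
    \<open>D 0 = 1\<close> into \<open>A' 1 = 1/2\<close>, where an integer is required, or
    \<open>A 0 = 1/2\<close> into \<open>D' 1 = 1\<close>, where an even number is required.\<close>
  define A :: "int \<Rightarrow> rat" where "A n = (if n = 0 then 1/2 else 0)" for n
  define D :: "int \<Rightarrow> rat" where "D n = (if n = 0 then 1 else 0)" for n
  have "linear_fun A (\<lambda>_. 0) D \<in> parity_lattice"
    by (rule parity_lattice_memI) (auto simp: A_def D_def)
  moreover assume "y_odd p 0 \<in> stabilizer parity_lattice"
  ultimately have "env_act (y_odd p 0) (linear_fun A (\<lambda>_. 0) D) \<in> parity_lattice"
    by (simp add: stabilizer_def)
  then obtain A' B' D' where
    eq: "env_act (y_odd p 0) (linear_fun A (\<lambda>_. 0) D) = linear_fun A' B' D'"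
    and "\<And>n. odd n \<Longrightarrow> A' n \<in> \<int>" "\<And>n. odd n \<Longrightarrow> D' n / 2 \<in> \<int>"
    by (rule parity_lattice_cases) blast
  then have "A' 1 \<in> \<int>" "D' 1 / 2 \<in> \<int>" by simp_all
  show False
  proof (cases p)
    case Plus
    then have "A' 1 = 1/2"
      using fun_cong [OF eq, of "(1, 0, 0, 1)"]
      by (simp add: y_odd_def env_act_mult env_act_scal X_linear_fun) (simp add: linear_fun_def D_def)
    with \<open>A' 1 \<in> \<int>\<close> show False by simp
  next
    case Minus
    then have "D' 1 = 1"
      using fun_cong [OF eq, of "(0, 0, 1, 1)"]
      by (simp add: y_odd_def env_act_mult env_act_scal X_linear_fun) (simp add: linear_fun_def A_def)
    with \<open>D' 1 / 2 \<in> \<int>\<close> show False by simp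
  qed
qed

lemma U_Z_strict: "U_Z \<subset> U_ZM"
proof -
  have "U_Z \<subseteq> stabilizer parity_lattice"
    unfolding U_Z_def by (intro int_subalg_least subring_parity) (auto simp: dpow_x_stabilizes)
  moreover have "y_odd Minus 0 \<in> U_ZM"
    using div_integral_y_odd_U_ZM [of Minus 0, unfolded div_integral_def, rule_format, of 1]
    by (simp add: dpow_def)
  ultimately show ?thesis
    using U_Z_subset y_notin_stabilizer by blast
qed

lemma U_Z_pm_strict: "U_Z_pm p \<subset> U_ZM_pm p"
proof -
  have "U_Z_pm p \<subseteq> stabilizer parity_lattice"
    unfolding U_Z_pm_def by (intro int_subalg_least subring_parity) (auto simp: dpow_x_stabilizes)
  then show ?thesis
    using U_Z_pm_subset y_notin_stabilizer y_odd_mem_U_ZM_pm by blast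
qed

lemma Zdiv_strict: "Zdiv (range (X_odd p)) \<subset> Zdiv (range (y_odd p))"
proof -
  have "Zdiv (range (X_odd p)) \<subseteq> stabilizer parity_lattice"
    unfolding Zdiv_def by (intro int_subalg_least subring_parity) (auto simp: dpow_X_stabilizes)
  moreover have "dpow (y_odd p 0) 1 \<in> Zdiv (range (y_odd p))"
    unfolding Zdiv_def by (rule int_subalg.base) auto
  then have "y_odd p 0 \<in> Zdiv (range (y_odd p))"
    by (simp add: dpow_def)
  ultimately show ?thesis
    using Zdiv_X_subset y_notin_stabilizer by blast
qed

lemma Zbin_strict: "Zbin {2 * hh 0, 4 * c_tilde} \<subset> Zbin {2 * hh 0, c_tilde - hh 0}"
proof -
  have "c_tilde - hh 0 \<notin> Zbin {2 * hh 0, 4 * c_tilde}"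
    unfolding two_hh_0 four_c_tilde by (rule c_tilde_minus_hh_notin)
  moreover have "ubinom (c_tilde - hh 0) 1 \<in> Zbin {2 * hh 0, c_tilde - hh 0}"
    using binomial_integral_Zbin unfolding binomial_integral_def by blast
  then have "c_tilde - hh 0 \<in> Zbin {2 * hh 0, c_tilde - hh 0}"
    by (simp add: ubinom_def)
  ultimately show ?thesis
    using Zbin_subset by blast
qed

theorem corollaryC9:
  shows "U_Z \<subset> U_ZM
    \<and> (\<forall>p. Zdiv (range (X_odd p)) \<subset> Zdiv (range (y_odd p)))
    \<and> U_Z_pm Plus \<subset> U_ZM_pm Plus
    \<and> U_Z_pm Minus \<subset> U_ZM_pm Minus
    \<and> Zbin {hU 0, cU} = Zbin {2 * hh 0, 4 * c_tilde}
    \<and> Zbin {2 * hh 0, 4 * c_tilde} \<subset> Zbin {2 * hh 0, c_tilde - hh 0}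
    \<and> Zsym (\<lambda>r. scal (eps (int r)) * hU (int r)) \<subset> Zsym (\<lambda>r. hh (int r))
    \<and> Zsym (\<lambda>r. scal (eps (int r)) * hU (- int r)) \<subset> Zsym (\<lambda>r. hh (- int r))
    \<and> U_Z_0 \<subset> U_ZM_0"
proof (intro conjI allI)
  show "Zbin {hU 0, cU} = Zbin {2 * hh 0, 4 * c_tilde}"
    by (simp only: two_hh_0 four_c_tilde)
  show "Zsym (\<lambda>r. scal (eps (int r)) * hU (int r)) \<subset> Zsym (\<lambda>r. hh (int r))"
    using Zsym_strict [of 1] by simp
  show "Zsym (\<lambda>r. scal (eps (int r)) * hU (- int r)) \<subset> Zsym (\<lambda>r. hh (- int r))"
    using Zsym_strict [of "- 1"] by simp
qed (fact U_Z_strict U_Z_pm_strict Zdiv_strict Zbin_strict U_Z_0_strict)+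

end
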